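(* The problems Trivially Perfect Completion and Trivially Perfect Deletion each admit a kernel with $O(k^3)$ vertices. That is, for each of the two problems there is an algorithm that, given an instance $(G,k)$, runs in time polynomial in $|V(G)|$ and $k$ and outputs an instance $(G',k')$ of the same problem such that $(G',k')$ is a yes-instance if and only if $(G,k)$ is, $|V(G')|=O(k^3)$, and $k'\le g(k)$ for some computable function $g$.
   Context: All graphs are finite, simple and undirected. A graph is trivially perfect if it contains neither $P_4$ nor $C_4$ as an induced subgraph. Trivially Perfect Completion: given a graph $G=(V,E)$ and $k\in\mathbb{N}$, decide whether there is a set $F$ of at most $k$ pairs of distinct vertices, disjoint from $E$, such that $(V,E\cup F)$ is trivially perfect. Trivially Perfect Deletion: given $G=(V,E)$ and $k$, decide whether there is $F\subseteq E$ with $|F|\le k$ such that $(V,E\setminus F)$ is trivially perfect. *)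

theory Defs
  imports Complex_Main "HOL-Library.Landau_Symbols" "HOL-Computational_Algebra.Polynomial"
begin

section \<open>Graphs\<close>

datatype 'a graph = Graph (verts: "'a set") (edges: "'a set set")

definition vertex_pairs :: "'a set \<Rightarrow> 'a set set" where
  "vertex_pairs V = {e. e \<subseteq> V \<and> card e = 2}"

definition simple_graph :: "'a graph \<Rightarrow> bool" where
  "simple_graph G \<longleftrightarrow> finite (verts G) \<and> edges G \<subseteq> vertex_pairs (verts G)"

definition induced_subgraph :: "'a graph \<Rightarrow> 'a set \<Rightarrow> 'a graph" where
  "induced_subgraph G W = Graph W {e \<in> edges G. e \<subseteq> W}"

definition graph_isomorphic :: "'a graph \<Rightarrow> 'b graph \<Rightarrow> bool" where
  "graph_isomorphic G H \<longleftrightarrow>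
     (\<exists>f. bij_betw f (verts G) (verts H) \<and> edges H = (\<lambda>e. f ` e) ` edges G)"

definition contains_induced :: "'a graph \<Rightarrow> 'b graph \<Rightarrow> bool" where
  "contains_induced G H \<longleftrightarrow>
     (\<exists>W \<subseteq> verts G. graph_isomorphic (induced_subgraph G W) H)"

definition P4 :: "nat graph" where
  "P4 = Graph {0, 1, 2, 3} {{0, 1}, {1, 2}, {2, 3}}"

definition C4 :: "nat graph" where
  "C4 = Graph {0, 1, 2, 3} {{0, 1}, {1, 2}, {2, 3}, {3, 0}}"

definition trivially_perfect :: "'a graph \<Rightarrow> bool" where
  "trivially_perfect G \<longleftrightarrow> \<not> contains_induced G P4 \<and> \<not> contains_induced G C4"

definition tp_completion :: "'a graph \<Rightarrow> nat \<Rightarrow> bool" where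
  "tp_completion G k \<longleftrightarrow>
     (\<exists>F. F \<subseteq> vertex_pairs (verts G) \<and> F \<inter> edges G = {} \<and> finite F \<and> card F \<le> k \<and>
          trivially_perfect (Graph (verts G) (edges G \<union> F)))"

definition tp_deletion :: "'a graph \<Rightarrow> nat \<Rightarrow> bool" where
  "tp_deletion G k \<longleftrightarrow>
     (\<exists>F. F \<subseteq> edges G \<and> finite F \<and> card F \<le> k \<and>
          trivially_perfect (Graph (verts G) (edges G - F)))"


section \<open>Model of computation\<close>

text \<open>
  Algorithms are while-programs for a random access machine. The memory consists of arrays of
  registers, each register holding a natural number; the array names in a program are constants, so a
  program uses only finitely many arrays, while indices into an array are computed. As usual for unit
  cost, the arithmetic operations are only addition and (truncated) subtraction: one step then
  increases the bit length of the largest number by at most a constant, so that polynomial time here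
  is polynomial time on Turing machines. Unit-cost multiplication would break this.
\<close>

type_synonym store = "nat \<Rightarrow> nat \<Rightarrow> nat"

datatype aexp = Num nat | Cell nat aexp | Plus aexp aexp | Minus aexp aexp

primrec aval :: "aexp \<Rightarrow> store \<Rightarrow> nat" where
  "aval (Num n) s = n"
| "aval (Cell a e) s = s a (aval e s)"
| "aval (Plus e1 e2) s = aval e1 s + aval e2 s"
| "aval (Minus e1 e2) s = aval e1 s - aval e2 s"

primrec acost :: "aexp \<Rightarrow> nat" where
  "acost (Num n) = 1"
| "acost (Cell a e) = acost e + 1"
| "acost (Plus e1 e2) = acost e1 + acost e2 + 1"
| "acost (Minus e1 e2) = acost e1 + acost e2 + 1"

text \<open>\<open>Assign a i e\<close> is \<open>a[i] := e\<close>; the tests of \<open>Cond\<close> and \<open>While\<close> succeed on nonzero values.\<close>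

datatype com =
    Skip
  | Assign nat aexp aexp
  | Seq com com
  | Cond aexp com com
  | While aexp com

text \<open>\<open>exec c s t s'\<close>: program \<open>c\<close> started in store \<open>s\<close> halts after \<open>t\<close> steps in store \<open>s'\<close>.\<close>

inductive exec :: "com \<Rightarrow> store \<Rightarrow> nat \<Rightarrow> store \<Rightarrow> bool" where
  exec_Skip: "exec Skip s 1 s"
| exec_Assign: "exec (Assign a i e) s (acost i + acost e + 1)
     (s(a := (s a)(aval i s := aval e s)))"
| exec_Seq: "exec c1 s t1 s1 \<Longrightarrow> exec c2 s1 t2 s2 \<Longrightarrow> exec (Seq c1 c2) s (t1 + t2) s2"
| exec_CondTrue: "aval b s \<noteq> 0 \<Longrightarrow> exec c1 s t s' \<Longrightarrow> exec (Cond b c1 c2) s (acost b + 1 + t) s'"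
| exec_CondFalse: "aval b s = 0 \<Longrightarrow> exec c2 s t s' \<Longrightarrow> exec (Cond b c1 c2) s (acost b + 1 + t) s'"
| exec_WhileFalse: "aval b s = 0 \<Longrightarrow> exec (While b c) s (acost b + 1) s"
| exec_WhileTrue: "aval b s \<noteq> 0 \<Longrightarrow> exec c s t1 s1 \<Longrightarrow> exec (While b c) s1 t2 s2 \<Longrightarrow>
     exec (While b c) s (acost b + 1 + t1 + t2) s2"

inductive_cases exec_SkipE: "exec Skip s t s'"
inductive_cases exec_AssignE: "exec (Assign a i e) s t s'"
inductive_cases exec_SeqE: "exec (Seq c1 c2) s t s'"
inductive_cases exec_CondE: "exec (Cond b c1 c2) s t s'"
inductive_cases exec_WhileE: "exec (While b c) s t s'"

lemma exec_deterministic: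
  "exec c s t s' \<Longrightarrow> exec c s u s'' \<Longrightarrow> u = t \<and> s'' = s'"
proof (induction arbitrary: u s'' rule: exec.induct)
  case exec_Skip
  then show ?case by (auto elim: exec_SkipE)
next
  case exec_Assign
  then show ?case by (auto elim: exec_AssignE)
next
  case exec_Seq
  from exec_Seq.prems show ?case
    by (rule exec_SeqE) (metis exec_Seq.IH)
next
  case exec_CondTrue
  from exec_CondTrue.prems show ?case
    by (rule exec_CondE) (use exec_CondTrue.hyps(1) in \<open>auto dest: exec_CondTrue.IH\<close>)
next
  case exec_CondFalse
  from exec_CondFalse.prems show ?case
    by (rule exec_CondE) (use exec_CondFalse.hyps(1) in \<open>auto dest: exec_CondFalse.IH\<close>)
next
  case exec_WhileFalse
  from exec_WhileFalse.prems show ?case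
    by (rule exec_WhileE) (use exec_WhileFalse.hyps in auto)
next
  case exec_WhileTrue
  from exec_WhileTrue.prems show ?case
    by (rule exec_WhileE) (use exec_WhileTrue.hyps(1) in \<open>auto dest: exec_WhileTrue.IH\<close>)
qed

definition computable :: "(nat \<Rightarrow> nat) \<Rightarrow> bool" where
  "computable g \<longleftrightarrow>
     (\<exists>c. \<forall>k. \<exists>t s'. exec c (\<lambda>a i. if a = 0 \<and> i = 0 then k else 0) t s' \<and> s' 0 0 = g k)"


section \<open>Kernels\<close>

text \<open>
  An instance \<open>(G, k)\<close> with vertex set \<open>{..<n}\<close> is presented by \<open>n\<close> and \<open>k\<close> in the first two cells of
  array 0 and the adjacency matrix of \<open>G\<close>, row by row, in array 1. On input, all other cells are 0;
  on output, they are ignored.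
\<close>

definition input_store :: "nat graph \<Rightarrow> nat \<Rightarrow> store" where
  "input_store G k = (\<lambda>a i.
     let n = card (verts G) in
     if a = 0 \<and> i = 0 then n
     else if a = 0 \<and> i = 1 then k
     else if a = 1 \<and> i < n * n \<and> {i div n, i mod n} \<in> edges G then 1
     else 0)"

definition holds_instance :: "store \<Rightarrow> nat graph \<Rightarrow> nat \<Rightarrow> bool" where
  "holds_instance s G k \<longleftrightarrow>
     simple_graph G \<and> verts G = {..<s 0 0} \<and> k = s 0 1 \<and>
     (\<forall>i < s 0 0. \<forall>j < s 0 0. s 1 (i * s 0 0 + j) = (if {i, j} \<in> edges G then 1 else 0))"

text \<open>
  The size bound is a function \<open>h\<close> of class \<open>O(f)\<close> that bounds the number of vertices for every
  \<open>k\<close>, including the finitely many \<open>k\<close> that the asymptotic notation disregards. The running time is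
  bounded by the bivariate polynomial \<open>p\<close>, evaluated at the number of vertices and at \<open>k\<close>.
\<close>

definition admits_vertex_kernel :: "(nat graph \<Rightarrow> nat \<Rightarrow> bool) \<Rightarrow> (nat \<Rightarrow> nat) \<Rightarrow> bool" where
  "admits_vertex_kernel Q f \<longleftrightarrow>
     (\<exists>c (p :: nat poly poly) h g.
        (\<lambda>k. real (h k)) \<in> O(\<lambda>k. real (f k)) \<and> computable g \<and>
        (\<forall>G n k. simple_graph G \<and> verts G = {..<n} \<longrightarrow>
           (\<exists>t s' G' k'.
              exec c (input_store G k) t s' \<and> t \<le> poly (poly p [:n:]) k \<and>
              holds_instance s' G' k' \<and>
              (Q G' k' \<longleftrightarrow> Q G k) \<and>
              card (verts G') \<le> h k \<and> k' \<le> g k)))"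

end

theory Submission
  imports Defs
begin

text \<open>
  Both \<open>P4\<close> and \<open>C4\<close> are captured by one kind of obstruction: a walk \<open>a, b, c, d\<close> with \<open>a c\<close> and
  \<open>b d\<close> non-adjacent. Call \<open>b\<close>, \<open>c\<close> its inner vertices. At most \<open>k\<close> edits touch at most \<open>2 k\<close>
  vertices, so among more than \<open>2 k\<close> candidates one is untouched; this single counting argument makes
  both reduction rules safe.

  Rule 1: a pair that lies in many obstructions which are otherwise disjoint has to be edited.

  Rule 2: let \<open>v\<close> be an inner vertex of no obstruction. The neighbours of \<open>v\<close> that have a neighbour
  outside \<open>N[v]\<close> form a clique \<open>A\<close> dominating \<open>N[v]\<close>, and the vertices \<open>x\<close> with \<open>N[x] \<subseteq> N[u]\<close>, for \<open>u\<close>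
  ranging over all such vertices with the same clique \<open>A\<close>, form a module with neighbourhood \<open>A\<close>. If
  this module has more than \<open>2 k + 1\<close> vertices, then \<open>v\<close> can be deleted: a solution of the rest leaves
  some vertex of the module untouched, and this vertex shows where to reinsert \<open>v\<close>.

  In a reduced yes-instance, Rule 1 yields a set \<open>Y\<close> of \<open>O(k\<^sup>2)\<close> vertices that contains both inner
  vertices and an end of every obstruction. The modules of Rule 2 belonging to the vertices outside \<open>Y\<close>
  with maximal closed neighbourhood cover everything outside \<open>Y\<close>; their cliques \<open>A \<subseteq> Y\<close> form a tree-like
  family and hence inject into \<open>Y\<close>, up to the empty one. This gives \<open>O(k\<^sup>3)\<close> vertices. A larger reduced
  instance is a no-instance and is replaced by \<open>P4\<close> with \<open>k = 0\<close>.
\<close>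

section \<open>Editing problems on relations\<close>

text \<open>A graph is a symmetric relation that is reflexive exactly on its vertices. With this convention
  \<open>r x z\<close> ranges over the closed neighbourhood of \<open>x\<close>, and an obstruction has four distinct vertices.\<close>

definition rgraph :: "('a \<Rightarrow> 'a \<Rightarrow> bool) \<Rightarrow> bool" where
  "rgraph r \<longleftrightarrow> finite {x. r x x} \<and> (\<forall>x y. r x y \<longrightarrow> r y x \<and> r x x)"

definition obs :: "('a \<Rightarrow> 'a \<Rightarrow> bool) \<Rightarrow> 'a \<Rightarrow> 'a \<Rightarrow> 'a \<Rightarrow> 'a \<Rightarrow> bool" where
  "obs r a b c d \<longleftrightarrow> r a b \<and> r b c \<and> r c d \<and> \<not> r a c \<and> \<not> r b d"

definition obs_free :: "('a \<Rightarrow> 'a \<Rightarrow> bool) \<Rightarrow> bool" where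
  "obs_free r \<longleftrightarrow> (\<forall>a b c d. \<not> obs r a b c d)"

text \<open>Unordered pairs, so that a symmetric change counts as one edit.\<close>

definition diffs :: "('a \<Rightarrow> 'a \<Rightarrow> bool) \<Rightarrow> ('a \<Rightarrow> 'a \<Rightarrow> bool) \<Rightarrow> 'a set set" where
  "diffs r h = {{x, y} | x y. r x y \<noteq> h x y}"

text \<open>\<open>pol\<close> is the value of \<open>r\<close> on the pairs that may be edited: \<open>False\<close> for completion, \<open>True\<close> for deletion.\<close>

definition solution :: "bool \<Rightarrow> ('a \<Rightarrow> 'a \<Rightarrow> bool) \<Rightarrow> nat \<Rightarrow> ('a \<Rightarrow> 'a \<Rightarrow> bool) \<Rightarrow> bool" where
  "solution pol r k h \<longleftrightarrow> rgraph h \<and> (\<forall>x. h x x = r x x) \<and>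
     (\<forall>x y. r x y \<noteq> h x y \<longrightarrow> r x y = pol) \<and> obs_free h \<and> card (diffs r h) \<le> k"

definition solvable :: "bool \<Rightarrow> ('a \<Rightarrow> 'a \<Rightarrow> bool) \<Rightarrow> nat \<Rightarrow> bool" where
  "solvable pol r k \<longleftrightarrow> (\<exists>h. solution pol r k h)"

lemma rgraph_sym: "rgraph r \<Longrightarrow> r x y \<longleftrightarrow> r y x"
  and rgraph_refl1: "rgraph r \<Longrightarrow> r x y \<Longrightarrow> r x x"
  and rgraph_refl2: "rgraph r \<Longrightarrow> r x y \<Longrightarrow> r y y"
  and rgraph_finite: "rgraph r \<Longrightarrow> finite {x. r x x}"
  unfolding rgraph_def by blast+

lemma rgraph_finite_nbrs: "rgraph r \<Longrightarrow> finite {x. r x y \<and> P x}" "rgraph r \<Longrightarrow> finite {x. r y x \<and> P x}"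
  by (rule finite_subset[OF _ rgraph_finite]; auto dest: rgraph_refl1 rgraph_refl2)+

lemma obs_rev: "rgraph r \<Longrightarrow> obs r a b c d \<longleftrightarrow> obs r d c b a"
  unfolding obs_def by (metis rgraph_sym)

lemma finite_diffs:
  assumes "rgraph r" "rgraph h" "\<And>x. h x x = r x x"
  shows "finite (diffs r h)"
proof -
  have "diffs r h \<subseteq> (\<lambda>(x, y). {x, y}) ` ({x. r x x} \<times> {x. r x x})"
    unfolding diffs_def using assms by (force dest: rgraph_refl1 rgraph_refl2)
  then show ?thesis
    using rgraph_finite[OF assms(1)] by (meson finite_SigmaI finite_imageI finite_subset)
qed

text \<open>Every edited pair has at most two elements, whence the factor 2 in the thresholds of
  both rules.\<close>

lemma card_touched:
  assumes "rgraph r" "solution pol r k h"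
  shows "finite (\<Union>(diffs r h))" "card (\<Union>(diffs r h)) \<le> 2 * k"
proof -
  have fin: "finite (diffs r h)"
    using assms by (intro finite_diffs) (auto simp: solution_def)
  show "finite (\<Union>(diffs r h))"
    using fin by (auto simp: diffs_def)
  have "card (\<Union>(diffs r h)) \<le> (\<Sum>e\<in>diffs r h. card e)"
    by (rule card_Union_le_sum_card)
  also have "\<dots> \<le> (\<Sum>e\<in>diffs r h. 2)"
    by (rule sum_mono) (auto simp: diffs_def card_insert_le_m1)
  also have "\<dots> \<le> 2 * k"
    using assms(2) by (simp add: solution_def)
  finally show "card (\<Union>(diffs r h)) \<le> 2 * k" .
qed

lemma untouched_eq:
  assumes "rgraph r" "rgraph h" "x \<notin> \<Union>(diffs r h)"
  shows "h x y = r x y" "h y x = r y x"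
  using assms unfolding diffs_def by auto

lemma large_not_touched:
  assumes "rgraph r" "solution pol r k h" "card B > 2 * k"
  shows "\<exists>x\<in>B. x \<notin> \<Union>(diffs r h)"
  using card_touched[OF assms(1,2)] assms(3) card_mono[of "\<Union>(diffs r h)" B]
  by (meson leD le_trans subsetI)

text \<open>Pulling back along an injection gives both heredity and isomorphism invariance.\<close>

lemma solvable_pullback:
  assumes r: "rgraph r" and inj: "inj_on f S" and fS: "\<And>x. x \<in> S \<Longrightarrow> r (f x) (f x)"
    and s: "solvable pol r k"
  shows "solvable pol (\<lambda>x y. x \<in> S \<and> y \<in> S \<and> r (f x) (f y)) k"
proof -
  obtain h where h: "solution pol r k h" using s by (auto simp: solvable_def)
  have hg: "rgraph h" using h by (simp add: solution_def)
  let ?r = "\<lambda>x y. x \<in> S \<and> y \<in> S \<and> r (f x) (f y)"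
  let ?h = "\<lambda>x y. x \<in> S \<and> y \<in> S \<and> h (f x) (f y)"
  have finS: "finite S"
    by (rule inj_on_finite[OF inj _ rgraph_finite[OF r]]) (use fS in auto)
  have "rgraph ?h"
    using hg finS unfolding rgraph_def by auto
  moreover have "obs_free ?h"
  proof -
    have False if "obs ?h a b c d" for a b c d
    proof -
      have "obs h (f a) (f b) (f c) (f d)" using that by (auto simp: obs_def)
      then show False using h by (auto simp: solution_def obs_free_def)
    qed
    then show ?thesis by (auto simp: obs_free_def)
  qed
  \<comment> \<open>Taking images under \<open>f\<close> maps differences to differences,
    injectively because they are subsets of \<open>S\<close>; so the cost does not grow.\<close>
  moreover have "card (diffs ?r ?h) \<le> card (diffs r h)"
  proof (rule card_inj_on_le)
    have sub: "e \<subseteq> S" if "e \<in> diffs ?r ?h" for e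
      using that by (auto simp: diffs_def)
    show "inj_on (image f) (diffs ?r ?h)"
      by (rule inj_on_subset[OF inj_on_image_Pow[OF inj]]) (use sub in auto)
    show "image f ` diffs ?r ?h \<subseteq> diffs r h"
    proof (rule image_subsetI)
      fix e assume "e \<in> diffs ?r ?h"
      then obtain x y where "e = {x, y}" "r (f x) (f y) \<noteq> h (f x) (f y)" by (auto simp: diffs_def)
      then show "f ` e \<in> diffs r h" by (auto simp: diffs_def)
    qed
    show "finite (diffs r h)"
      using h r by (intro finite_diffs) (auto simp: solution_def)
  qed
  ultimately have "solution pol ?r k ?h"
    using h unfolding solution_def by fastforce
  then show ?thesis by (auto simp: solvable_def)
qed

section \<open>The reduction rules\<close>

definition flip_pair :: "('a \<Rightarrow> 'a \<Rightarrow> bool) \<Rightarrow> 'a \<Rightarrow> 'a \<Rightarrow> 'a \<Rightarrow> 'a \<Rightarrow> bool" where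
  "flip_pair r p q = (\<lambda>x y. if {x, y} = {p, q} then \<not> r x y else r x y)"

definition del_vertex :: "('a \<Rightarrow> 'a \<Rightarrow> bool) \<Rightarrow> 'a \<Rightarrow> 'a \<Rightarrow> 'a \<Rightarrow> bool" where
  "del_vertex r v = (\<lambda>x y. r x y \<and> x \<noteq> v \<and> y \<noteq> v)"

lemma flip_pair_refl: "p \<noteq> q \<Longrightarrow> flip_pair r p q x x = r x x"
  by (auto simp: flip_pair_def doubleton_eq_iff)

lemma rgraph_flip_pair:
  assumes "rgraph r" "p \<noteq> q" "r p p" "r q q"
  shows "rgraph (flip_pair r p q)"
  using assms unfolding rgraph_def flip_pair_refl[OF assms(2)]
  by (auto simp: flip_pair_def doubleton_eq_iff)

lemma rgraph_del_vertex: "rgraph r \<Longrightarrow> rgraph (del_vertex r v)"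
  unfolding rgraph_def del_vertex_def by auto

text \<open>If every solution edits the pair, the edit may be made in advance at the price of one
  unit. Conversely, the flipped pair has the value that no edit may change, so a solution of the
  flipped instance never undoes it.\<close>

lemma solvable_flip_pair:
  assumes r: "rgraph r" and pq: "p \<noteq> q" "r p q = pol" and k: "k > 0"
    and forced: "\<And>h. solution pol r k h \<Longrightarrow> h p q \<noteq> pol"
  shows "solvable pol (flip_pair r p q) (k - 1) \<longleftrightarrow> solvable pol r k"
proof
  assume "solvable pol r k"
  then obtain h where h: "solution pol r k h" by (auto simp: solvable_def)
  have hg: "rgraph h" using h by (simp add: solution_def)
  have hpq: "h p q \<noteq> pol" "h q p \<noteq> pol" using forced[OF h] hg by (auto simp: rgraph_sym)
  have rqp: "r q p = pol" using pq r by (auto simp: rgraph_sym)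
  have "diffs (flip_pair r p q) h \<subseteq> diffs r h - {{p, q}}"
    using pq rqp hpq by (auto simp: diffs_def flip_pair_def doubleton_eq_iff split: if_splits)
  moreover have "{p, q} \<in> diffs r h" using pq hpq by (auto simp: diffs_def)
  moreover have "finite (diffs r h)"
    using h r by (intro finite_diffs) (auto simp: solution_def)
  ultimately have "card (diffs (flip_pair r p q) h) \<le> card (diffs r h) - 1"
    by (metis card_Diff_singleton card_mono finite_Diff)
  moreover have "flip_pair r p q x y = pol" if "flip_pair r p q x y \<noteq> h x y" for x y
    using that h hpq pq rqp unfolding solution_def
    by (auto simp: flip_pair_def doubleton_eq_iff split: if_splits)
  ultimately have "solution pol (flip_pair r p q) (k - 1) h"
    using h by (auto simp: solution_def flip_pair_refl[OF pq(1)])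
  then show "solvable pol (flip_pair r p q) (k - 1)" by (auto simp: solvable_def)
next
  assume "solvable pol (flip_pair r p q) (k - 1)"
  then obtain h where h: "solution pol (flip_pair r p q) (k - 1) h" by (auto simp: solvable_def)
  have hg: "rgraph h" and refl: "\<And>x. h x x = r x x"
    using h by (auto simp: solution_def flip_pair_refl[OF pq(1)])
  have rqp: "r q p = pol" using pq r by (auto simp: rgraph_sym)
  have "flip_pair r p q p q \<noteq> pol" using pq by (auto simp: flip_pair_def)
  then have hpq: "h p q \<noteq> pol" "h q p \<noteq> pol"
    using h hg unfolding solution_def by (metis, metis rgraph_sym)
  have fin: "finite (diffs r h)"
    using r hg refl by (rule finite_diffs)
  have sub: "diffs r h - {{p, q}} \<subseteq> diffs (flip_pair r p q) h"
    by (auto simp: diffs_def flip_pair_def)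
  have "finite (diffs (flip_pair r p q) h)"
    by (rule finite_subset[OF _ finite.insertI[OF fin, of "{p,q}"]])
       (auto simp: diffs_def flip_pair_def split: if_splits)
  then have "card (diffs r h - {{p, q}}) \<le> k - 1"
    using card_mono[OF _ sub] h by (auto simp: solution_def)
  then have "card (diffs r h) \<le> k"
    using k card_Diff1_le[of "diffs r h" "{p,q}"] fin
    by (simp add: card_Diff_singleton_if split: if_splits)
  moreover have "r x y = pol" if "r x y \<noteq> h x y" for x y
  proof (cases "{x, y} = {p, q}")
    case True
    then show ?thesis using pq rqp by (auto simp: doubleton_eq_iff)
  next
    case False
    then show ?thesis using that h unfolding solution_def flip_pair_def by metis
  qed
  ultimately have "solution pol r k h"
    using h refl by (auto simp: solution_def)
  then show "solvable pol r k" by (auto simp: solvable_def)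
qed

text \<open>Counts the vertices that complete the pair to an obstruction. For deletion,
  \<open>p q\<close> is an end edge of \<open>p q c d\<close> or the middle edge of
  \<open>a p q d\<close>, where the two ends are counted separately; for completion,
  \<open>p\<close> and \<open>q\<close> are the first and third vertex of \<open>p b q d\<close>.
  The witness \<open>d\<close> may vary with the counted vertex. The threshold is that of
  \<open>removable\<close>, so that one counting quantifier expresses both rules.\<close>

definition forced :: "bool \<Rightarrow> ('a \<Rightarrow> 'a \<Rightarrow> bool) \<Rightarrow> nat \<Rightarrow> 'a \<Rightarrow> 'a \<Rightarrow> bool" where
  "forced pol r k p q \<longleftrightarrow> r p p \<and> r q q \<and> r p q = pol \<and>
    (if pol
     then card {c. r q c \<and> \<not> r p c \<and> (\<exists>d. r c d \<and> \<not> r q d)} > 2 * k + 1 \<or>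
          card {a. r a p \<and> \<not> r a q} > 2 * k + 1 \<and> card {d. r q d \<and> \<not> r p d} > 2 * k + 1
     else card {b. r p b \<and> r b q \<and> (\<exists>d. r q d \<and> \<not> r b d)} > 2 * k + 1)"

text \<open>Suppose \<open>h\<close> keeps the pair. Counted vertices that \<open>h\<close> leaves
  untouched fix the adjacencies of an obstruction through the pair, up to at most one that edits of
  the given polarity cannot change; so the obstruction survives in \<open>h\<close>.\<close>

lemma forcedD:
  assumes r: "rgraph r" and f: "forced pol r k p q"
  shows "p \<noteq> q" "r p q = pol" "r p p" "r q q" "\<And>h. solution pol r k h \<Longrightarrow> h p q \<noteq> pol"
proof -
  show "r p q = pol" "r p p" "r q q" using f by (auto simp: forced_def)
  show "p \<noteq> q"
  proof
    \<comment> \<open>Under deletion, a set that has to be large would be empty; under completion,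
      \<open>r p p\<close> contradicts \<open>r p q = pol\<close>.\<close>
    assume eq: "p = q"
    have e: "{c. r q c \<and> \<not> r p c \<and> (\<exists>d. r c d \<and> \<not> r q d)} = {}" "{d. r q d \<and> \<not> r p d} = {}"
      using eq by auto
    show False using f eq unfolding forced_def e by (auto split: if_splits)
  qed
  fix h assume h: "solution pol r k h"
  have hg: "rgraph h" and free: "\<And>a b c d. \<not> obs h a b c d"
    using h by (auto simp: solution_def obs_free_def)
  note big = large_not_touched[OF r h] and same = untouched_eq[OF r hg]
  show "h p q \<noteq> pol"
  proof
    assume hpq: "h p q = pol"
    show False
    proof (cases pol)
      case True
      have le: "r x y" if "h x y" for x y using h that True by (auto simp: solution_def)
      consider "card {c. r q c \<and> \<not> r p c \<and> (\<exists>d. r c d \<and> \<not> r q d)} > 2 * k"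
        | "card {a. r a p \<and> \<not> r a q} > 2 * k" "card {d. r q d \<and> \<not> r p d} > 2 * k"
        using f True by (force simp: forced_def)
      then show False
      proof cases
        case 1
        from big[OF this] obtain c d where c: "r q c" "\<not> r p c" "r c d" "\<not> r q d"
          "c \<notin> \<Union>(diffs r h)" by auto
        \<comment> \<open>The non-edge \<open>q d\<close> is the only pair involved that avoids both
          \<open>c\<close> and the kept pair; deletion cannot turn it into an edge.\<close>
        then have "obs h p q c d" using same[OF c(5)] le hpq True by (auto simp: obs_def)
        then show False using free by blast
      next
        case 2
        from big[OF 2(1)] obtain a where a: "r a p" "\<not> r a q" "a \<notin> \<Union>(diffs r h)" by auto
        from big[OF 2(2)] obtain d where d: "r q d" "\<not> r p d" "d \<notin> \<Union>(diffs r h)" by auto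
        have "obs h a p q d" using same[OF a(3)] same[OF d(3)] a d hpq True by (auto simp: obs_def)
        then show False using free by blast
      qed
    next
      case False
      have le: "h x y" if "r x y" for x y using h that False by (auto simp: solution_def)
      have "card {b. r p b \<and> r b q \<and> (\<exists>d. r q d \<and> \<not> r b d)} > 2 * k"
        using f False by (force simp: forced_def)
      from big[OF this] obtain b d where b: "r p b" "r b q" "r q d" "\<not> r b d"
        "b \<notin> \<Union>(diffs r h)" by auto
      \<comment> \<open>Here the only pair that avoids both \<open>b\<close> and the kept pair is
        the edge \<open>q d\<close>, which completion cannot remove.\<close>
      then have "obs h p b q d" using same[OF b(5)] le hpq False by (auto simp: obs_def)
      then show False using free by blast
    qed
  qed
qed

text \<open>As \<open>r\<close> is reflexive on vertices, this is inclusion of closed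
  neighbourhoods.\<close>

definition nbr_le :: "('a \<Rightarrow> 'a \<Rightarrow> bool) \<Rightarrow> 'a \<Rightarrow> 'a \<Rightarrow> bool" where
  "nbr_le r x u \<longleftrightarrow> (\<forall>z. r x z \<longrightarrow> r u z)"

text \<open>By \<open>obs_rev\<close>, this covers the third position of an obstruction as well as
  the second.\<close>

definition inner :: "('a \<Rightarrow> 'a \<Rightarrow> bool) \<Rightarrow> 'a \<Rightarrow> bool" where
  "inner r v \<longleftrightarrow> (\<exists>a c d. obs r a v c d)"

text \<open>The clique \<open>A\<close> of Rule 2: the second conjunct says that \<open>w\<close>
  has a neighbour outside the closed neighbourhood of \<open>v\<close>.\<close>

definition above :: "('a \<Rightarrow> 'a \<Rightarrow> bool) \<Rightarrow> 'a \<Rightarrow> 'a set" where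
  "above r v = {w. r v w \<and> \<not> nbr_le r w v}"

text \<open>The module of Rule 2. It is a function of the clique alone, so all vertices
  \<open>u\<close> with the same clique share it. Its members may themselves be inner
  vertices.\<close>

definition below :: "('a \<Rightarrow> 'a \<Rightarrow> bool) \<Rightarrow> 'a set \<Rightarrow> 'a set" where
  "below r A = {x. r x x \<and> (\<exists>u. r u u \<and> \<not> inner r u \<and> nbr_le r x u \<and> above r u = A)}"

text \<open>The module contains \<open>v\<close> itself; the threshold leaves more than
  \<open>2 k\<close> other members.\<close>

definition removable :: "('a \<Rightarrow> 'a \<Rightarrow> bool) \<Rightarrow> nat \<Rightarrow> 'a \<Rightarrow> bool" where
  "removable r k v \<longleftrightarrow> r v v \<and> \<not> inner r v \<and> card (below r (above r v)) > 2 * k + 1"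

text \<open>Some neighbour \<open>z\<close> of \<open>w\<close> is not adjacent to \<open>v\<close>.
  If \<open>x\<close> were not adjacent to \<open>w\<close>, then \<open>x v w z\<close> would be an
  obstruction with \<open>v\<close> in an inner position.\<close>

lemma above_dominates:
  assumes "rgraph r" "\<not> inner r v" "w \<in> above r v" "r v x"
  shows "r x w" "r w x"
proof -
  from assms(3) obtain z where "r v w" "r w z" "\<not> r v z" by (auto simp: above_def nbr_le_def)
  then show "r x w" "r w x"
    using assms unfolding inner_def obs_def by (metis rgraph_sym)+
qed

text \<open>A neighbour of \<open>x\<close> is a neighbour of the witness \<open>u\<close>, and a
  neighbour of \<open>u\<close> either belongs to the clique of \<open>u\<close> or has its closed
  neighbourhood inside that of \<open>u\<close>. Hence \<open>below r A\<close> is a module with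
  neighbourhood \<open>A\<close>.\<close>

lemma below_nbrs:
  assumes r: "rgraph r" and x: "x \<in> below r A"
  shows "x \<notin> A" "\<And>w. w \<in> A \<Longrightarrow> r x w" "\<And>y. r x y \<Longrightarrow> y \<in> A \<or> y \<in> below r A"
proof -
  from x obtain u where u: "r x x" "r u u" "\<not> inner r u" "nbr_le r x u" "above r u = A"
    by (auto simp: below_def)
  have rux: "r u x" using u by (auto simp: nbr_le_def)
  show "x \<notin> A" using u by (auto simp: above_def)
  show "r x w" if "w \<in> A" for w
    using above_dominates[OF r u(3) _ rux] that u(5) by auto
  show "y \<in> A \<or> y \<in> below r A" if "r x y" for y
  proof -
    have ruy: "r u y" using that u by (auto simp: nbr_le_def)
    show ?thesis
    proof (cases "nbr_le r y u")
      case True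
      then show ?thesis using u ruy rgraph_refl2[OF r ruy] by (auto simp: below_def)
    next
      case False
      then show ?thesis using u ruy by (auto simp: above_def)
    qed
  qed
qed

text \<open>One direction is heredity. For the other, \<open>h'\<close> keeps a solution
  \<open>h\<close> of the rest, except that \<open>A\<close> becomes a clique again, the module
  \<open>M\<close> is joined to exactly \<open>A\<close> again, and inside \<open>M\<close> the
  component of \<open>v\<close> is separated from the others and dominated by \<open>v\<close>
  again. This only undoes edits, so the cost does not grow. An obstruction of \<open>h'\<close>
  would yield one of \<open>h\<close>, possibly with an untouched member \<open>m\<close> of
  \<open>M\<close> as a vertex.\<close>

lemma solvable_del_vertex:
  assumes r: "rgraph r" and rem: "removable r k v"
  shows "solvable pol (del_vertex r v) k \<longleftrightarrow> solvable pol r k"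
proof
  assume "solvable pol r k"
  then have "solvable pol (\<lambda>x y. x \<in> {x. r x x \<and> x \<noteq> v} \<and> y \<in> {x. r x x \<and> x \<noteq> v} \<and> r (id x) (id y)) k"
    by (intro solvable_pullback[OF r]) auto
  moreover have "(\<lambda>x y. x \<in> {x. r x x \<and> x \<noteq> v} \<and> y \<in> {x. r x x \<and> x \<noteq> v} \<and> r (id x) (id y)) = del_vertex r v"
    by (intro ext) (auto simp: del_vertex_def dest: rgraph_refl1[OF r] rgraph_refl2[OF r])
  ultimately show "solvable pol (del_vertex r v) k" by simp
next
  define A where "A = above r v"
  define M where "M = below r A"
  define g where "g = del_vertex r v"
  have gr: "rgraph g" using r by (simp add: g_def rgraph_del_vertex)
  have v: "r v v" "\<not> inner r v" and big: "card M > 2 * k + 1"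
    using rem by (auto simp: removable_def M_def A_def)
  have vM: "v \<in> M" using v by (auto simp: M_def below_def A_def nbr_le_def)
  note Mn = below_nbrs[OF r, of _ A, folded M_def]
  have Adom: "r w w" if "w \<in> A" for w
    using that by (auto simp: A_def above_def dest: rgraph_refl2[OF r])
  have Mdom: "r x x" if "x \<in> M" for x using that by (auto simp: M_def below_def)
  have vA: "r v w" if "w \<in> A" for w using that by (auto simp: A_def above_def)
  have Acl: "r w w'" if "w \<in> A" "w' \<in> A" for w w'
    using above_dominates[OF r v(2)] that vA by (auto simp: A_def)
  \<comment> \<open>A neighbour of \<open>v\<close> in \<open>M\<close> is not in \<open>A\<close>,
    so its neighbours are neighbours of \<open>v\<close>. Hence the closed neighbourhood of
    \<open>v\<close> within \<open>M\<close> is a component of \<open>r\<close> on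
    \<open>M\<close>.\<close>
  have comp: "r v y" if "r v x" "x \<in> M" "r x y" "y \<in> M" for x y
  proof -
    have "nbr_le r x v" using that Mn(1) by (auto simp: A_def above_def)
    then show ?thesis using that by (auto simp: nbr_le_def)
  qed
  assume "solvable pol (del_vertex r v) k"
  then obtain h where h: "solution pol g k h" by (auto simp: solvable_def g_def)
  have hg: "rgraph h" and hrefl: "\<And>x. h x x = g x x" and free: "\<And>a b c d. \<not> obs h a b c d"
    and hpol: "\<And>x y. g x y \<noteq> h x y \<Longrightarrow> g x y = pol" and hk: "card (diffs g h) \<le> k"
    using h by (auto simp: solution_def obs_free_def)
  have "card (M - {v}) > 2 * k" using big by (cases "finite M") (auto simp: card_Diff_singleton_if)
  from large_not_touched[OF gr h this]
  obtain m where m: "m \<in> M" "m \<noteq> v" "m \<notin> \<Union>(diffs g h)" by auto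
  \<comment> \<open>Since \<open>m\<close> is untouched, \<open>h\<close> joins it to all of
    \<open>A\<close> and to nothing else outside \<open>M\<close>.\<close>
  have mA: "h m w" "h w m" if "w \<in> A" for w
    using untouched_eq[OF gr hg m(3)] Mn(2)[OF m(1) that] m(2) that Mn(1)[OF vM]
    by (auto simp: g_def del_vertex_def rgraph_sym[OF r])
  have mR: "\<not> h m x" "\<not> h x m" if "x \<notin> A" "x \<notin> M" for x
    using untouched_eq[OF gr hg m(3)] Mn(3)[OF m(1)] that rgraph_sym[OF r, of x m]
    by (auto simp: g_def del_vertex_def)
  \<comment> \<open>\<open>K\<close> collects the pairs on which the edits of \<open>h\<close> are undone; on them \<open>h\<close> need not respect the module \<open>M\<close>.\<close>
  define K where "K x y \<longleftrightarrow> x \<in> A \<and> y \<in> A \<or> x \<in> M \<and> y \<in> M \<and> (x = v \<or> y = v \<or> r v x \<noteq> r v y)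
     \<or> x \<in> M \<and> y \<notin> M \<or> x \<notin> M \<and> y \<in> M" for x y
  define h' where "h' x y \<longleftrightarrow> (if K x y then r x y else h x y)" for x y
  have Ksym: "K x y \<longleftrightarrow> K y x" for x y by (auto simp: K_def)
  have h'g: "rgraph h'" and h'refl: "h' x x = r x x" for x
  proof -
    show refl: "h' x x = r x x" for x
      by (auto simp: h'_def hrefl g_def del_vertex_def K_def vM)
    have fin: "finite {x. r x x}" by (rule rgraph_finite[OF r])
    have "h' y x \<and> h' x x" if "h' x y" for x y
    proof (cases "K x y")
      case True
      then show ?thesis using that Ksym[of x y] refl rgraph_sym[OF r, of x y] rgraph_refl1[OF r, of x y]
        by (simp add: h'_def)
    next
      case False
      then have "h x y" using that by (simp add: h'_def)
      then have "h y x" "h x x" using hg by (auto simp: rgraph_sym dest: rgraph_refl1)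
      then show ?thesis using False Ksym[of x y] refl[of x] hrefl[of x]
        by (simp add: h'_def[of y x] g_def del_vertex_def)
    qed
    then show "rgraph h'" using fin refl by (auto simp: rgraph_def)
  qed
  \<comment> \<open>\<open>K\<close> holds for every pair that contains \<open>v\<close>. So a
    difference between \<open>r\<close> and \<open>h'\<close> avoids \<open>v\<close>, where
    \<open>g\<close> agrees with \<open>r\<close>, and is already a difference between
    \<open>g\<close> and \<open>h\<close>.\<close>
  have diffK: "\<not> K x y \<and> g x y = r x y \<and> h' x y = h x y" if "r x y \<noteq> h' x y" for x y
  proof -
    have nK: "\<not> K x y" using that by (auto simp: h'_def)
    then have "x \<noteq> v" "y \<noteq> v" using vM by (auto simp: K_def)
    then show ?thesis using nK by (simp add: g_def del_vertex_def h'_def)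
  qed
  have "diffs r h' \<subseteq> diffs g h"
    using diffK by (fastforce simp: diffs_def)
  moreover have "finite (diffs g h)" using gr hg hrefl by (rule finite_diffs)
  ultimately have "card (diffs r h') \<le> k" using hk card_mono le_trans by blast
  moreover have "r x y = pol" if "r x y \<noteq> h' x y" for x y
    using diffK[OF that] hpol[of x y] that by auto
  moreover have "obs_free h'"
  proof -
    have AA: "h' x y" if "x \<in> A" "y \<in> A" for x y using Acl that by (simp add: h'_def K_def)
    have MA: "h' x y" "h' y x" if "x \<in> M" "y \<in> A" for x y
      using Mn(1,2) that rgraph_sym[OF r, of x y] by (auto simp: h'_def K_def)
    have MR: "y \<in> A \<or> y \<in> M" if "x \<in> M" "h' x y \<or> h' y x" for x y
      using Mn(3)[OF that(1), of y] that rgraph_sym[OF r, of x y] by (auto simp: h'_def K_def split: if_splits)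
    have MM: "r v x = r v y" if "h' x y" "x \<in> M" "y \<in> M" for x y
      using that comp[of x y] comp[of y x] rgraph_sym[OF r, of x y] v(1)
      by (auto simp: h'_def K_def split: if_splits)
    have MMh: "h' x y = h x y" if "x \<in> M" "y \<in> M" "x \<noteq> v" "y \<noteq> v" "r v x = r v y" for x y
      using that Mn(1) by (auto simp: h'_def K_def)
    have Mv: "h' v y = r v y" "h' y v = r y v" if "y \<in> M" for y
      using that vM by (auto simp: h'_def K_def)
    have out: "h' x y = h x y" if "x \<notin> M" "y \<notin> M" "x \<notin> A \<or> y \<notin> A" for x y
      using that by (auto simp: h'_def K_def)
    \<comment> \<open>No obstruction of \<open>h'\<close> has its first or second vertex in
      \<open>M\<close>; by reversal, none meets \<open>M\<close> at all.\<close>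
    have half: "a \<notin> M \<and> b \<notin> M" if o: "obs h' a b c d" for a b c d
    proof (rule ccontr)
      have e: "h' a b" "h' b c" "h' c d" "\<not> h' a c" "\<not> h' b d" using o by (auto simp: obs_def)
      assume "\<not> (a \<notin> M \<and> b \<notin> M)"
      then consider "b \<in> M" | "a \<in> M" "b \<notin> M" by blast
      then show False
      proof cases
        case 1
        have c: "c \<in> M" using MR[of b c] MR[of b a] MA AA e 1 by blast
        have a: "a \<in> M" using MR[of b a] MA e 1 c by blast
        have d: "d \<in> M" using MR[of c d] MA e 1 c by blast
        \<comment> \<open>Vertices of \<open>M\<close> adjacent in \<open>h'\<close> agree on
          adjacency to \<open>v\<close>, so all four lie in one class. If \<open>v\<close> were one
          of them, it would be adjacent to the others, but every vertex of an obstruction has a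
          non-neighbour in it.\<close>
        have eq: "r v a = r v b" "r v c = r v b" "r v d = r v b"
          using MM[OF e(1)] MM[OF e(2)] MM[OF e(3)] 1 a c d by auto
        have "v \<notin> {a, b, c, d}"
          using eq v(1) e Mv(1)[OF c] Mv(1)[OF d] Mv(2)[OF a] Mv(2)[OF 1]
            rgraph_sym[OF r, of v a] rgraph_sym[OF r, of v b] by auto
        then have "obs h a b c d"
          using e MMh eq 1 a c d by (auto simp: obs_def)
        then show False using free by blast
      next
        case 2
        have b: "b \<in> A" using MR[of a b] e 2 by blast
        have d: "d \<notin> A" "d \<notin> M" using AA MA e b by blast+
        have c: "c \<notin> A" "c \<notin> M" using MA[of a c] MR[of c d] e 2 d by blast+
        \<comment> \<open>\<open>m\<close> takes the place of \<open>a\<close>: it is adjacent to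
          \<open>b\<close> and not to \<open>c\<close>, and on the pairs among \<open>b\<close>,
          \<open>c\<close>, \<open>d\<close> the relations \<open>h\<close> and \<open>h'\<close>
          agree, because \<open>c\<close> and \<open>d\<close> are outside \<open>A\<close>.\<close>
        have "obs h m b c d"
          using mA[OF b] mR[OF c] e out[of b c] out[of c d] out[of b d] 2 b c d by (auto simp: obs_def)
        then show False using free by blast
      qed
    qed
    have False if o: "obs h' a b c d" for a b c d
    proof -
      have e: "h' a b" "h' b c" "h' c d" "\<not> h' a c" "\<not> h' b d" using o by (auto simp: obs_def)
      have nM: "a \<notin> M" "b \<notin> M" "c \<notin> M" "d \<notin> M"
        using half[OF o] half[of d c b a] o obs_rev[OF h'g, of a b c d] by auto
      \<comment> \<open>Outside \<open>M\<close>, the two relations differ only on pairs in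
        \<open>A\<close>. If \<open>h\<close> lacks such an end edge \<open>a b\<close>, then it has
        the obstruction \<open>a m b c\<close>.\<close>
      have ends: False if "obs h' a b c d" "a \<in> A" "b \<in> A" "a \<notin> M" "b \<notin> M" "c \<notin> M" "d \<notin> M"
        "\<not> h a b" for a b c d
      proof -
        have f: "h' b c" "\<not> h' a c" using that by (auto simp: obs_def)
        have c: "c \<notin> A" using AA f that by blast
        have "obs h a m b c"
          using mA that f out[of b c] mR[OF c that(6)] c by (auto simp: obs_def)
        then show False using free by blast
      qed
      have ab: "h a b" using ends[OF o] out[of a b] nM e by blast
      have dc: "h d c"
        using ends[of d c b a] o out[of d c] nM e rgraph_sym[OF h'g, of c d] obs_rev[OF h'g, of a b c d]
        by blast
      have bc: "\<not> h b c"
      proof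
        assume "h b c"
        moreover have "\<not> h a c" "\<not> h b d" using AA e out[of a c] out[of b d] nM by blast+
        ultimately have "obs h a b c d"
          using ab dc rgraph_sym[OF hg, of c d] by (auto simp: obs_def)
        then show False using free by blast
      qed
      then have bcA: "b \<in> A" "c \<in> A" using out[of b c] nM e by blast+
      then have a: "a \<notin> A" using AA e by blast
      \<comment> \<open>If \<open>h\<close> lacks the middle edge \<open>b c\<close>, then
        \<open>m\<close> subdivides it.\<close>
      have "obs h a b m c" using ab bc mA bcA mR[OF a nM(1)] by (auto simp: obs_def)
      then show False using free by blast
    qed
    then show ?thesis by (auto simp: obs_free_def)
  qed
  ultimately have "solution pol r k h'"
    using h'g h'refl by (auto simp: solution_def)
  then show "solvable pol r k" by (auto simp: solvable_def)
qed

section \<open>The size of reduced instances\<close>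

text \<open>Vertices outside \<open>Y\<close> are inner to no obstruction, and each lies below a
  maximal one. The maximal ones have at most \<open>card Y + 1\<close> different cliques, the
  summand 1 standing for the empty clique, and each clique accounts for a module of at most
  \<open>s\<close> vertices.\<close>

lemma card_vertices_le:
  assumes r: "rgraph r" and Y: "finite Y"
    and cover: "\<And>a b c d. obs r a b c d \<Longrightarrow> b \<in> Y \<and> c \<in> Y \<and> (a \<in> Y \<or> d \<in> Y)"
    and small: "\<And>v. r v v \<Longrightarrow> \<not> inner r v \<Longrightarrow> card (below r (above r v)) \<le> s"
  shows "card {x. r x x} \<le> card Y + (card Y + 1) * s"
proof -
  define U where "U = {x. r x x \<and> x \<notin> Y}"
  define top where "top v \<longleftrightarrow> v \<in> U \<and> (\<forall>u\<in>U. nbr_le r v u \<longrightarrow> nbr_le r u v)" for v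
  define T where "T = above r ` {v. top v}"
  note fin = rgraph_finite[OF r]
  have finU: "finite U" using fin by (auto simp: U_def)
  have finT: "finite T" using finU by (auto simp: T_def top_def)
  have Ui: "r u u" "u \<notin> Y" "\<not> inner r u" if "u \<in> U" for u
    using that cover by (auto simp: U_def inner_def)
  have trans: "nbr_le r x z" if "nbr_le r x y" "nbr_le r y z" for x y z
    using that by (auto simp: nbr_le_def)
  \<comment> \<open>A vertex with the largest closed neighbourhood among those above
    \<open>u\<close> is maximal.\<close>
  have ex_top: "\<exists>v. top v \<and> nbr_le r u v" if u: "u \<in> U" for u
  proof -
    let ?S = "{v \<in> U. nbr_le r u v}"
    have "finite ?S" "u \<in> ?S" using finU u by (auto simp: nbr_le_def)
    then have "Max ((\<lambda>w. card {z. r w z}) ` ?S) \<in> (\<lambda>w. card {z. r w z}) ` ?S"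
      by (intro Max_in) auto
    then obtain v where v: "v \<in> ?S" and "Max ((\<lambda>w. card {z. r w z}) ` ?S) = card {z. r v z}"
      by blast
    then have mx: "card {z. r w z} \<le> card {z. r v z}" if "w \<in> ?S" for w
      using Max_ge[of "(\<lambda>w. card {z. r w z}) ` ?S" "card {z. r w z}"] that finU by auto
    have "nbr_le r w v" if "w \<in> U" "nbr_le r v w" for w
    proof -
      have "w \<in> ?S" using v that trans by blast
      then have "card {z. r w z} \<le> card {z. r v z}" by (rule mx)
      moreover have "{z. r v z} \<subseteq> {z. r w z}" using that by (auto simp: nbr_le_def)
      ultimately have "{z. r v z} = {z. r w z}"
        using card_seteq rgraph_finite_nbrs(2)[OF r, of w "\<lambda>_. True"] by auto
      then show ?thesis by (auto simp: nbr_le_def)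
    qed
    then show ?thesis using v by (auto simp: top_def)
  qed
  \<comment> \<open>A vertex of the clique of \<open>v\<close> dominates the closed neighbourhood of
    \<open>v\<close>; were it outside \<open>Y\<close>, maximality of \<open>v\<close> would make
    the neighbourhoods equal.\<close>
  have above_Y: "above r v \<subseteq> Y" if v: "top v" for v
  proof
    fix w assume w: "w \<in> above r v"
    have vU: "v \<in> U" using v by (simp add: top_def)
    show "w \<in> Y"
    proof (rule ccontr)
      assume "w \<notin> Y"
      moreover have "r w w" using w by (auto simp: above_def dest: rgraph_refl2[OF r])
      ultimately have "w \<in> U" by (simp add: U_def)
      moreover have "nbr_le r v w" using above_dominates[OF r Ui(3)[OF vU] w] by (auto simp: nbr_le_def)
      ultimately have "nbr_le r w v" using v by (auto simp: top_def)
      then show False using w by (simp add: above_def)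
    qed
  qed
  have clique: "r x y" if "A \<in> T" "x \<in> A" "y \<in> A" for A x y
  proof -
    from that obtain v where v: "top v" "A = above r v" by (auto simp: T_def)
    then have "\<not> inner r v" using Ui by (auto simp: top_def)
    from above_dominates(1)[OF r this, of y x] show ?thesis using that v by (auto simp: above_def)
  qed
  \<comment> \<open>If \<open>v\<close> were adjacent to \<open>z\<close>, the closed neighbourhood
    of \<open>z\<close>, which contains \<open>v'\<close>, would lie in that of \<open>v\<close>. As
    \<open>v'\<close> is not in the clique of \<open>v\<close>, its neighbourhood would lie in that
    of \<open>v\<close> too; maximality of \<open>v'\<close> makes the two equal, and their cliques
    with them.\<close>
  have apart: "\<not> r v z" if "top v" "top v'" "y \<in> above r v" "y \<notin> above r v'"
    "z \<in> above r v'" "z \<notin> above r v" for v v' y z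
  proof
    assume vz: "r v z"
    have U: "v \<in> U" "v' \<in> U" using that by (auto simp: top_def)
    have "r z v'" using that rgraph_sym[OF r] by (auto simp: above_def)
    moreover have "nbr_le r z v" using vz that by (auto simp: above_def)
    ultimately have "r v v'" by (auto simp: nbr_le_def)
    moreover have "v' \<notin> above r v" using above_Y[OF that(1)] Ui(2)[OF U(2)] by auto
    ultimately have le: "nbr_le r v' v" by (auto simp: above_def)
    then have "nbr_le r v v'" using that U by (auto simp: top_def)
    with le have "r v = r v'" by (auto simp: nbr_le_def)
    then have "above r v = above r v'" by (auto simp: above_def nbr_le_def)
    then show False using that by auto
  qed
  \<comment> \<open>Otherwise \<open>v y z v'\<close> would be an obstruction with both ends outside
    \<open>Y\<close>; here \<open>cover\<close> is needed for an end.\<close>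
  have cross: "\<not> r y z" if "A \<in> T" "B \<in> T" "y \<in> A" "y \<notin> B" "z \<in> B" "z \<notin> A" for A B y z
  proof
    assume yz: "r y z"
    from that obtain v v' where v: "top v" "A = above r v" "top v'" "B = above r v'" by (auto simp: T_def)
    have "\<not> r v z" "\<not> r v' y" using apart[of v v' y z] apart[of v' v z y] v that by auto
    moreover have "r v y" "r v' z" using v that by (auto simp: above_def)
    ultimately have "obs r v y z v'" using yz rgraph_sym[OF r, of v' y] rgraph_sym[OF r, of v' z] by (auto simp: obs_def)
    then show False using cover[of v y z v'] v Ui(2) by (auto simp: top_def)
  qed
  have pick: "\<exists>x\<in>A. \<forall>B\<in>T. x \<in> B \<longrightarrow> A \<subseteq> B" if A: "A \<in> T" "A \<noteq> {}" for A
  proof -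
    \<comment> \<open>An element of \<open>A\<close> that lies in the fewest members of \<open>T\<close> has the required property.\<close>
    let ?n = "\<lambda>x. card {B \<in> T. x \<in> B}"
    obtain x where x: "x \<in> A" and mn: "\<And>y. y \<in> A \<Longrightarrow> ?n x \<le> ?n y"
      using A(2) ex_has_least_nat[of "\<lambda>x. x \<in> A" _ ?n] by blast
    have "A \<subseteq> B" if B: "B \<in> T" "x \<in> B" for B
    proof
      fix y assume y: "y \<in> A"
      show "y \<in> B"
      proof (rule ccontr)
        assume yB: "y \<notin> B"
        \<comment> \<open>A member \<open>C\<close> of \<open>T\<close> with \<open>y\<close> but
          without \<open>x\<close> would contradict \<open>cross\<close> for \<open>B\<close> and
          \<open>C\<close>, because \<open>x\<close> and \<open>y\<close> are adjacent in the clique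
          \<open>A\<close>.\<close>
        have "{C \<in> T. y \<in> C} \<subseteq> {C \<in> T. x \<in> C}"
          using cross[of B _ x y] clique[OF A(1) x y] B yB by blast
        then have "{C \<in> T. y \<in> C} \<subset> {C \<in> T. x \<in> C}" using B yB by blast
        then have "?n y < ?n x" using finT by (intro psubset_card_mono) auto
        then show False using mn[OF y] by simp
      qed
    qed
    then show ?thesis using x by blast
  qed
  then obtain f where f: "\<And>A. A \<in> T - {{}} \<Longrightarrow> f A \<in> A \<and> (\<forall>B\<in>T. f A \<in> B \<longrightarrow> A \<subseteq> B)"
    by (metis (lifting) DiffD1 DiffD2 insertI1)
  \<comment> \<open>\<open>A\<close> is the least member of \<open>T\<close> that contains
    \<open>f A\<close>.\<close>
  have "inj_on f (T - {{}})"
    by (rule inj_onI) (metis DiffD1 f subset_antisym)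
  moreover have "f ` (T - {{}}) \<subseteq> Y"
    using f above_Y by (fastforce simp: T_def)
  ultimately have "card (T - {{}}) \<le> card Y" using Y by (rule card_inj_on_le)
  then have cT: "card T \<le> card Y + 1"
    using card_Diff1_le[of T "{}"] finT by (simp add: card_Diff_singleton_if split: if_splits)
  have "{x. r x x} \<subseteq> Y \<union> (\<Union>A\<in>T. below r A)"
  proof
    fix x assume "x \<in> {x. r x x}"
    then have x: "r x x" by simp
    show "x \<in> Y \<union> (\<Union>A\<in>T. below r A)"
    proof (cases "x \<in> Y")
      case False
      then have "x \<in> U" using x by (simp add: U_def)
      then obtain v where v: "top v" "nbr_le r x v" using ex_top by blast
      then have "x \<in> below r (above r v)"
        using x Ui by (auto simp: below_def top_def)
      then show ?thesis using v by (auto simp: T_def)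
    qed simp
  qed
  moreover have finb: "finite (below r A)" for A
    by (rule finite_subset[OF _ fin]) (auto simp: below_def)
  ultimately have "card {x. r x x} \<le> card (Y \<union> (\<Union>A\<in>T. below r A))"
    using Y finT by (intro card_mono) auto
  also have "\<dots> \<le> card Y + card (\<Union>A\<in>T. below r A)" by (rule card_Un_le)
  also have "card (\<Union>A\<in>T. below r A) \<le> (\<Sum>A\<in>T. card (below r A))"
    using finT by (rule card_UN_le)
  also have "\<dots> \<le> (\<Sum>A\<in>T. s)"
    by (rule sum_mono) (use small Ui in \<open>auto simp: T_def top_def\<close>)
  also have "\<dots> = card T * s" by simp
  also have "\<dots> \<le> (card Y + 1) * s" using cT by (rule mult_right_mono) simp
  finally show ?thesis by simp
qed

text \<open>Rule 1 spends a unit of the budget, hence the guard \<open>k > 0\<close>.\<close>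

definition reduced :: "bool \<Rightarrow> ('a \<Rightarrow> 'a \<Rightarrow> bool) \<Rightarrow> nat \<Rightarrow> bool" where
  "reduced pol r k \<longleftrightarrow> (\<forall>p q. \<not> (k > 0 \<and> forced pol r k p q)) \<and> (\<forall>v. \<not> removable r k v)"

text \<open>A pair is not forced if one of certain sets is small; \<open>few\<close> keeps just the small ones.\<close>

definition few :: "nat \<Rightarrow> 'a set \<Rightarrow> 'a set" where
  "few k B = (if card B \<le> 2 * k + 1 then B else {})"

lemma card_few: "card (few k B) \<le> 2 * k + 1"
  by (simp add: few_def)

text \<open>For deletion, these are candidates for the third vertex \<open>c\<close> if
  \<open>p q\<close> is an end edge, and for the end \<open>a\<close> next to \<open>p\<close> if it
  is the middle edge; for completion, for the vertex \<open>b\<close> between \<open>p\<close> and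
  \<open>q\<close>. The end next to \<open>q\<close> is a partner of the reversed pair.\<close>

definition partners :: "bool \<Rightarrow> ('a \<Rightarrow> 'a \<Rightarrow> bool) \<Rightarrow> nat \<Rightarrow> 'a \<Rightarrow> 'a \<Rightarrow> 'a set" where
  "partners pol r k p q =
    (if pol
     then few k {c. r q c \<and> \<not> r p c \<and> (\<exists>d. r c d \<and> \<not> r q d)} \<union> few k {a. r a p \<and> \<not> r a q}
     else few k {b. r p b \<and> r b q \<and> (\<exists>d. r q d \<and> \<not> r b d)})"

text \<open>Each obstruction is destroyed by one of the at most \<open>k\<close> edits of a
  solution. As the edited pair is not forced, the other vertices needed for the cover come from its
  small sets of partners. So the edited pairs and their partners form a set \<open>Y\<close> as in
  \<open>card_vertices_le\<close>.\<close>

lemma reduced_solvable_card_le: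
  assumes r: "rgraph r" and red: "reduced pol r k" and s: "solvable pol r k"
  shows "card {x. r x x} \<le> 16 * (k + 1) ^ 3"
proof -
  obtain h where h: "solution pol r k h" using s by (auto simp: solvable_def)
  have hg: "rgraph h" and hrefl: "\<And>x. h x x = r x x" and free: "\<And>a b c d. \<not> obs h a b c d"
    and hpol: "\<And>x y. r x y \<noteq> h x y \<Longrightarrow> r x y = pol" and hk: "card (diffs r h) \<le> k"
    using h by (auto simp: solution_def obs_free_def)
  have finD: "finite (diffs r h)" using r hg hrefl by (rule finite_diffs)
  let ?P = "partners pol r k"
  define Z where "Z e = {y. \<exists>p q. e = {p, q} \<and> (y = p \<or> y \<in> ?P p q)}" for e
  define Y where "Y = (\<Union>e\<in>diffs r h. Z e)"
  have finP: "finite (?P p q)" for p q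
    using rgraph_finite_nbrs[OF r] by (simp add: partners_def few_def)
  have cP: "card (?P p q) \<le> 4 * k + 2" for p q
  proof (cases pol)
    case True
    have "card (few k B \<union> few k C) \<le> 4 * k + 2" for B C :: "'a set"
      using card_Un_le[of "few k B" "few k C"] card_few[of k B] card_few[of k C] by simp
    then show ?thesis using True by (simp add: partners_def)
  next
    case False
    have "card (few k B) \<le> 4 * k + 2" for B :: "'a set" using card_few[of k B] by simp
    then show ?thesis using False by (simp add: partners_def)
  qed
  have Zeq: "Z {p, q} = {p, q} \<union> (?P p q \<union> ?P q p)" for p q
    by (auto simp: Z_def doubleton_eq_iff)
  \<comment> \<open>Two ends and the partners in both orientations:
    \<open>2 + 2 * (4 * k + 2)\<close>.\<close>
  have cZ: "finite (Z e) \<and> card (Z e) \<le> 8 * k + 6" if "e \<in> diffs r h" for e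
  proof -
    from that obtain p q where e: "e = {p, q}" by (auto simp: diffs_def)
    have "card (Z e) \<le> card {p, q} + card (?P p q \<union> ?P q p)" unfolding e Zeq by (rule card_Un_le)
    also have "card (?P p q \<union> ?P q p) \<le> card (?P p q) + card (?P q p)" by (rule card_Un_le)
    finally show ?thesis
      using cP[of p q] cP[of q p] finP card_insert_le_m1[of 2 "{q}" p] by (auto simp: e Zeq)
  qed
  have finY: "finite Y" using finD cZ by (auto simp: Y_def)
  have "card Y \<le> (\<Sum>e\<in>diffs r h. card (Z e))" unfolding Y_def using finD by (rule card_UN_le)
  also have "\<dots> \<le> (\<Sum>e\<in>diffs r h. 8 * k + 6)" using cZ by (intro sum_mono) auto
  also have "\<dots> \<le> k * (8 * k + 6)" using hk by simp
  finally have cY: "card Y \<le> k * (8 * k + 6)" .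
  \<comment> \<open>An edit needs a positive budget, so the guard in \<open>reduced\<close> holds at
    every edited pair.\<close>
  have kpos: "k > 0" if "r x y \<noteq> h x y" for x y
    using that hk finD by (auto simp: diffs_def card_gt_0_iff intro!: gr0I)
  have inY: "x \<in> Y" "y \<in> Y" "z \<in> ?P x y \<Longrightarrow> z \<in> Y" "z \<in> ?P y x \<Longrightarrow> z \<in> Y" if "r x y \<noteq> h x y" for x y z
  proof -
    have "{x, y} \<in> diffs r h" using that by (auto simp: diffs_def)
    then show "x \<in> Y" "y \<in> Y" "z \<in> ?P x y \<Longrightarrow> z \<in> Y" "z \<in> ?P y x \<Longrightarrow> z \<in> Y"
      unfolding Y_def using Zeq[of x y] by blast+
  qed
  have nf: "\<not> forced pol r k p q" if "k > 0" for p q using red that by (auto simp: reduced_def)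
  have cover: "b \<in> Y \<and> c \<in> Y \<and> (a \<in> Y \<or> d \<in> Y)" if o: "obs r a b c d" for a b c d
  proof (cases pol)
    case True
    have ends: "b \<in> Y \<and> c \<in> Y \<and> a \<in> Y" if o: "obs r a b c d" and ab: "\<not> h a b" for a b c d
    proof -
      have e: "r a b" "r b c" "r c d" "\<not> r a c" "\<not> r b d" using o by (auto simp: obs_def)
      have ne: "r a b \<noteq> h a b" using e ab by simp
      have "c \<in> ?P a b"
        using nf[OF kpos[OF ne], of a b] True e rgraph_refl1[OF r e(1)] rgraph_refl2[OF r e(1)]
        by (auto simp: forced_def partners_def few_def)
      then show ?thesis using inY[OF ne] by auto
    qed
    have e: "r a b" "r b c" "r c d" "\<not> r a c" "\<not> r b d" using o by (auto simp: obs_def)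
    have "\<not> h a c" "\<not> h b d" using hpol e True by metis+
    then consider "\<not> h a b" | "\<not> h d c" | "\<not> h b c"
      using free[of a b c d] rgraph_sym[OF hg, of c d] by (auto simp: obs_def)
    then show ?thesis
    proof cases
      case 1
      then show ?thesis using ends[OF o] by auto
    next
      case 2
      then show ?thesis using ends[of d c b a] o obs_rev[OF r, of a b c d] by auto
    next
      case 3
      then have ne: "r b c \<noteq> h b c" using e by simp
      \<comment> \<open>The middle edge was deleted without being forced, so one of its two end sets
        is small, and the end on that side is a partner. Nothing is learnt about the other end,
        which is why the cover asks for one end only.\<close>
      have "{y. r c y \<and> \<not> r b y} = {y. r y c \<and> \<not> r y b}"
        by (intro Collect_cong) (use rgraph_sym[OF r, of c] rgraph_sym[OF r, of b] in blast)
      moreover have "\<not> (card {y. r y b \<and> \<not> r y c} > 2 * k + 1 \<and> card {y. r c y \<and> \<not> r b y} > 2 * k + 1)"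
        using nf[OF kpos[OF ne], of b c] True e(2) rgraph_refl1[OF r e(2)] rgraph_refl2[OF r e(2)]
        unfolding forced_def by meson
      ultimately consider "card {y. r y b \<and> \<not> r y c} \<le> 2 * k + 1" | "card {y. r y c \<and> \<not> r y b} \<le> 2 * k + 1"
        by (metis not_less)
      then have "a \<in> ?P b c \<or> d \<in> ?P c b"
      proof cases
        case 1
        then have "a \<in> few k {y. r y b \<and> \<not> r y c}" using e by (simp add: few_def)
        then show ?thesis using True by (simp add: partners_def)
      next
        case 2
        moreover have "r d c" "\<not> r d b" using e rgraph_sym[OF r, of d] by blast+
        ultimately have "d \<in> few k {y. r y c \<and> \<not> r y b}" by (simp add: few_def)
        then show ?thesis using True by (simp add: partners_def)
      qed
      then show ?thesis using inY[OF ne] by auto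
    qed
  next
    case False
    \<comment> \<open>The filled pair is \<open>a c\<close> or, by reversal, \<open>d b\<close>; the
      vertex between its two ends is then a partner.\<close>
    have ends: "b \<in> Y \<and> c \<in> Y \<and> a \<in> Y" if o: "obs r a b c d" and ac: "h a c" for a b c d
    proof -
      have e: "r a b" "r b c" "r c d" "\<not> r a c" "\<not> r b d" using o by (auto simp: obs_def)
      have ne: "r a c \<noteq> h a c" using e ac by simp
      have "b \<in> ?P a c"
        using nf[OF kpos[OF ne], of a c] False e rgraph_refl1[OF r e(1)] rgraph_refl2[OF r e(2)]
        by (auto simp: forced_def partners_def few_def)
      then show ?thesis using inY[OF ne] by auto
    qed
    have e: "r a b" "r b c" "r c d" "\<not> r a c" "\<not> r b d" using o by (auto simp: obs_def)
    have "h a b" "h b c" "h c d" using hpol e False by metis+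
    then consider "h a c" | "h d b"
      using free[of a b c d] rgraph_sym[OF hg, of d b] by (auto simp: obs_def)
    then show ?thesis
      using ends[OF o] ends[of d c b a] o obs_rev[OF r, of a b c d] by cases auto
  qed
  have small: "card (below r (above r v)) \<le> 2 * k + 1" if "r v v" "\<not> inner r v" for v
    using red that by (auto simp: reduced_def removable_def not_less)
  have "card {x. r x x} \<le> card Y + (card Y + 1) * (2 * k + 1)"
    using r finY cover small by (rule card_vertices_le)
  also have "\<dots> \<le> k * (8 * k + 6) + (k * (8 * k + 6) + 1) * (2 * k + 1)"
    using cY by (intro add_mono mult_mono) auto
  also have "\<dots> \<le> 16 * (k + 1) ^ 3" by (simp add: algebra_simps power3_eq_cube)
  finally show ?thesis .
qed

section \<open>Trivially perfect graphs\<close>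

definition rel_of :: "'a graph \<Rightarrow> 'a \<Rightarrow> 'a \<Rightarrow> bool" where
  "rel_of G x y \<longleftrightarrow> x = y \<and> x \<in> verts G \<or> {x, y} \<in> edges G"

lemma simple_graph_edgeD:
  assumes "simple_graph G" "{x, y} \<in> edges G"
  shows "x \<noteq> y" "x \<in> verts G" "y \<in> verts G"
proof -
  have "{x, y} \<subseteq> verts G" "card {x, y} = 2"
    using assms by (auto simp: simple_graph_def vertex_pairs_def)
  then show "x \<noteq> y" "x \<in> verts G" "y \<in> verts G" by auto
qed

lemma simple_graph_edge_pair: "simple_graph G \<Longrightarrow> e \<in> edges G \<Longrightarrow> \<exists>x y. e = {x, y} \<and> x \<noteq> y"
  unfolding simple_graph_def vertex_pairs_def card_2_iff by blast

lemma rel_of_refl: "simple_graph G \<Longrightarrow> rel_of G x x \<longleftrightarrow> x \<in> verts G"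
  using simple_graph_edgeD(1)[of G x x] by (auto simp: rel_of_def)

lemma rel_of_edge: "x \<noteq> y \<Longrightarrow> rel_of G x y \<longleftrightarrow> {x, y} \<in> edges G"
  by (auto simp: rel_of_def)

lemma rgraph_rel_of:
  assumes "simple_graph G"
  shows "rgraph (rel_of G)"
proof -
  have "finite (verts G)" using assms by (simp add: simple_graph_def)
  then show ?thesis
    using assms unfolding rgraph_def rel_of_refl[OF assms]
    by (auto simp: rel_of_def insert_commute dest: simple_graph_edgeD)
qed

lemma isomorphic_edge_iff:
  assumes "bij_betw f W (verts H)" "edges H = (\<lambda>e. f ` e) ` edges (induced_subgraph G W)" "x \<in> W" "y \<in> W"
  shows "{f x, f y} \<in> edges H \<longleftrightarrow> {x, y} \<in> edges G"
proof -
  have inj: "inj_on f W" using assms(1) by (simp add: bij_betw_def)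
  have eq: "e = {x, y}" if "e \<subseteq> W" "f ` e = {f x, f y}" for e
    using inj_on_image_eq_iff[OF inj that(1), of "{x, y}"] that(2) assms(3,4) by auto
  have E: "edges H = (\<lambda>e. f ` e) ` {e \<in> edges G. e \<subseteq> W}"
    using assms(2) by (simp add: induced_subgraph_def)
  show ?thesis
  proof
    assume "{f x, f y} \<in> edges H"
    then obtain e where "e \<in> edges G" "e \<subseteq> W" "f ` e = {f x, f y}" unfolding E by auto
    then show "{x, y} \<in> edges G" using eq by blast
  next
    assume "{x, y} \<in> edges G"
    then have "f ` {x, y} \<in> edges H" unfolding E using assms(3,4) by blast
    then show "{f x, f y} \<in> edges H" by simp
  qed
qed

text \<open>The two graphs differ only in the pair \<open>{3, 0}\<close>, which \<open>obs\<close>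
  leaves open.\<close>

lemma contains_induced_obs:
  assumes G: "simple_graph G" and H: "H = P4 \<or> H = C4" and c: "contains_induced G H"
  shows "\<exists>a b c d. obs (rel_of G) a b c d"
proof -
  from c obtain W f where f: "bij_betw f W (verts H)"
    "edges H = (\<lambda>e. f ` e) ` edges (induced_subgraph G W)"
    by (auto simp: contains_induced_def graph_isomorphic_def induced_subgraph_def)
  have "verts H = {0, 1, 2, 3}" using H by (auto simp: P4_def C4_def)
  then have img: "f ` W = {0, 1, 2, 3}" using f(1) by (simp add: bij_betw_def)
  have "0 \<in> f ` W" "1 \<in> f ` W" "2 \<in> f ` W" "3 \<in> f ` W" unfolding img by simp_all
  then obtain a b c d where w: "a \<in> W" "f a = 0" "b \<in> W" "f b = 1" "c \<in> W" "f c = 2" "d \<in> W" "f d = 3"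
    by auto
  note iff = isomorphic_edge_iff[OF f]
  have "{a, b} \<in> edges G" "{b, c} \<in> edges G" "{c, d} \<in> edges G" "{a, c} \<notin> edges G" "{b, d} \<notin> edges G"
    unfolding iff[OF w(1,3), symmetric] iff[OF w(3,5), symmetric] iff[OF w(5,7), symmetric]
      iff[OF w(1,5), symmetric] iff[OF w(3,7), symmetric]
    using w H by (auto simp: P4_def C4_def doubleton_eq_iff)
  moreover have "a \<noteq> c" "b \<noteq> d" using w by auto
  ultimately show ?thesis unfolding obs_def rel_of_def by blast
qed

text \<open>The adjacencies force the four vertices to be distinct; the pair \<open>{d, a}\<close>
  then decides between \<open>C4\<close> and \<open>P4\<close>.\<close>

lemma obs_contains_induced:
  assumes G: "simple_graph G" and o: "obs (rel_of G) a b c d"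
  shows "contains_induced G P4 \<or> contains_induced G C4"
proof -
  let ?r = "rel_of G"
  have r: "rgraph ?r" using G by (rule rgraph_rel_of)
  have o': "?r a b" "?r b c" "?r c d" "\<not> ?r a c" "\<not> ?r b d" using o by (auto simp: obs_def)
  have ne: "a \<noteq> b" "a \<noteq> c" "a \<noteq> d" "b \<noteq> c" "b \<noteq> d" "c \<noteq> d"
    using o' rgraph_sym[OF r] rgraph_refl1[OF r] rgraph_refl2[OF r] by metis+
  have E: "{a, b} \<in> edges G" "{b, c} \<in> edges G" "{c, d} \<in> edges G" "{a, c} \<notin> edges G" "{b, d} \<notin> edges G"
    using o' ne by (auto simp: rel_of_def)
  let ?W = "{a, b, c, d}"
  have W: "?W \<subseteq> verts G" using E simple_graph_edgeD[OF G] by blast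
  define f where "f x = (if x = a then 0 else if x = b then 1 else if x = c then 2 else (3::nat))" for x
  have f: "f a = 0" "f b = 1" "f c = 2" "f d = 3" using ne by (auto simp: f_def)
  have bij: "bij_betw f ?W {0, 1, 2, 3}" using f by (auto simp: bij_betw_def inj_on_def)
  have pairs: "e \<in> {{a,b},{b,c},{c,d},{d,a}}" if eG: "e \<in> edges G" and eW: "e \<subseteq> ?W" for e
  proof -
    obtain x y where e: "e = {x, y}" "x \<noteq> y" using simple_graph_edge_pair[OF G eG] by blast
    then have "x \<in> ?W" "y \<in> ?W" using eW by auto
    then show ?thesis using e eG E(4,5) by (elim insertE emptyE; simp add: insert_commute)
  qed
  show ?thesis
  proof (cases "{d, a} \<in> edges G")
    case True
    then have "{e \<in> edges G. e \<subseteq> ?W} = {{a,b},{b,c},{c,d},{d,a}}" using pairs E by blast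
    then have "graph_isomorphic (induced_subgraph G ?W) C4"
      unfolding graph_isomorphic_def induced_subgraph_def C4_def using bij f by (intro exI[of _ f]) auto
    then show ?thesis unfolding contains_induced_def using W by blast
  next
    case False
    then have "{e \<in> edges G. e \<subseteq> ?W} = {{a,b},{b,c},{c,d}}" using pairs E by blast
    then have "graph_isomorphic (induced_subgraph G ?W) P4"
      unfolding graph_isomorphic_def induced_subgraph_def P4_def using bij f by (intro exI[of _ f]) auto
    then show ?thesis unfolding contains_induced_def using W by blast
  qed
qed

lemma trivially_perfect_iff_obs_free:
  assumes "simple_graph G"
  shows "trivially_perfect G \<longleftrightarrow> obs_free (rel_of G)"
proof
  assume "trivially_perfect G"
  then show "obs_free (rel_of G)"
    using obs_contains_induced[OF assms] by (auto simp: trivially_perfect_def obs_free_def)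
next
  assume "obs_free (rel_of G)"
  then show "trivially_perfect G"
    using contains_induced_obs[OF assms, of P4] contains_induced_obs[OF assms, of C4]
    by (auto simp: trivially_perfect_def obs_free_def)
qed

lemma rel_of_graph_of_rel:
  assumes "rgraph h" "\<And>x. h x x \<longleftrightarrow> x \<in> V"
  shows "rel_of (Graph V {{x, y} | x y. x \<noteq> y \<and> h x y}) = h"
proof (intro ext)
  fix x y
  have "{x, y} \<in> {{x, y} | x y. x \<noteq> y \<and> h x y} \<longleftrightarrow> x \<noteq> y \<and> h x y"
    using rgraph_sym[OF assms(1), of x y] by (auto simp: doubleton_eq_iff)
  then show "rel_of (Graph V {{x, y} | x y. x \<noteq> y \<and> h x y}) x y = h x y"
    using assms(2)[of x] by (cases "x = y") (simp_all add: rel_of_def)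
qed

lemma simple_graph_of_rel:
  assumes "rgraph h"
  shows "simple_graph (Graph {x. h x x} {{x, y} | x y. x \<noteq> y \<and> h x y})"
proof -
  have "{x, y} \<in> vertex_pairs {x. h x x}" if "x \<noteq> y" "h x y" for x y
    using that rgraph_refl1[OF assms that(2)] rgraph_refl2[OF assms that(2)] by (simp add: vertex_pairs_def)
  then show ?thesis using rgraph_finite[OF assms] by (auto simp: simple_graph_def)
qed

definition edit_problem :: "bool \<Rightarrow> 'a graph \<Rightarrow> nat \<Rightarrow> bool" where
  "edit_problem pol = (if pol then tp_deletion else tp_completion)"

text \<open>Speaking of the resulting edge set \<open>E\<close> instead of the edits brings both
  problems close to the shape of \<open>solution\<close>.\<close>

lemma edit_problem_iff_supergraph:
  assumes G: "simple_graph G"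
  shows "edit_problem pol G k \<longleftrightarrow> (\<exists>E. E \<subseteq> vertex_pairs (verts G) \<and>
    (if pol then E \<subseteq> edges G \<and> card (edges G - E) \<le> k else edges G \<subseteq> E \<and> card (E - edges G) \<le> k) \<and>
    trivially_perfect (Graph (verts G) E))" (is "_ \<longleftrightarrow> (\<exists>E. ?R E)")
proof -
  have GE: "edges G \<subseteq> vertex_pairs (verts G)" using G by (simp add: simple_graph_def)
  have fin: "finite (vertex_pairs (verts G))"
    using G by (auto simp: simple_graph_def vertex_pairs_def)
  show ?thesis
  proof (cases pol)
    case True
    show ?thesis
    proof
      assume "edit_problem pol G k"
      then obtain F where "F \<subseteq> edges G" "card F \<le> k" "trivially_perfect (Graph (verts G) (edges G - F))"
        using True by (auto simp: edit_problem_def tp_deletion_def)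
      moreover from this have "edges G - (edges G - F) = F" by blast
      ultimately have "?R (edges G - F)" using True GE by auto
      then show "\<exists>E. ?R E" by blast
    next
      assume "\<exists>E. ?R E"
      then obtain E where E: "?R E" by blast
      then have "edges G - (edges G - E) = E" using True by auto
      then have "tp_deletion G k"
        unfolding tp_deletion_def using E True GE fin
        by (intro exI[of _ "edges G - E"]) (auto intro: finite_subset)
      then show "edit_problem pol G k" using True by (simp add: edit_problem_def)
    qed
  next
    case False
    show ?thesis
    proof
      assume "edit_problem pol G k"
      then obtain F where "F \<subseteq> vertex_pairs (verts G)" "F \<inter> edges G = {}" "card F \<le> k"
        "trivially_perfect (Graph (verts G) (edges G \<union> F))"
        using False by (auto simp: edit_problem_def tp_completion_def)
      moreover from this have "edges G \<union> F - edges G = F" by blast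
      ultimately have "?R (edges G \<union> F)" using False GE by auto
      then show "\<exists>E. ?R E" by blast
    next
      assume "\<exists>E. ?R E"
      then obtain E where E: "?R E" by blast
      then have "edges G \<union> (E - edges G) = E" using False by auto
      then have "tp_completion G k"
        unfolding tp_completion_def using E False GE fin
        by (intro exI[of _ "E - edges G"]) (auto intro: finite_subset)
      then show "edit_problem pol G k" using False by (simp add: edit_problem_def)
    qed
  qed
qed

lemma edit_problem_iff_solvable:
  assumes G: "simple_graph G"
  shows "edit_problem pol G k \<longleftrightarrow> solvable pol (rel_of G) k"
proof -
  let ?V = "verts G"
  let ?R = "\<lambda>E. if pol then E \<subseteq> edges G \<and> card (edges G - E) \<le> k else edges G \<subseteq> E \<and> card (E - edges G) \<le> k"
  have finV: "finite ?V" using G by (simp add: simple_graph_def)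
  have simp: "simple_graph (Graph ?V E)" if "E \<subseteq> vertex_pairs ?V" for E
    using that finV by (simp add: simple_graph_def)
  have key: "?R E \<longleftrightarrow> (\<forall>x y. rel_of G x y \<noteq> rel_of (Graph ?V E) x y \<longrightarrow> rel_of G x y = pol) \<and>
      card (diffs (rel_of G) (rel_of (Graph ?V E))) \<le> k" (is "_ \<longleftrightarrow> ?pol \<and> _") if E: "E \<subseteq> vertex_pairs ?V" for E
  proof -
    note sE = simp[OF E]
    have d: "rel_of G x y \<noteq> rel_of (Graph ?V E) x y \<longleftrightarrow> ({x, y} \<in> edges G) \<noteq> ({x, y} \<in> E)" for x y
      using simple_graph_edgeD[OF G, of x y] simple_graph_edgeD[OF sE, of x y] by (auto simp: rel_of_def)
    \<comment> \<open>The vertex sets agree, so the relations differ exactly in the symmetric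
      difference of the edge sets; the polarity says which half of it is empty.\<close>
    have diffs: "diffs (rel_of G) (rel_of (Graph ?V E)) = (edges G - E) \<union> (E - edges G)"
      unfolding diffs_def d
    proof (intro set_eqI iffI)
      fix e assume "e \<in> (edges G - E) \<union> (E - edges G)"
      moreover from this obtain x y where "e = {x, y}"
        using simple_graph_edge_pair[OF G, of e] simple_graph_edge_pair[OF sE, of e] by auto
      ultimately show "e \<in> {{x, y} | x y. ({x, y} \<in> edges G) \<noteq> ({x, y} \<in> E)}" by blast
    qed blast
    have "?pol \<longleftrightarrow> (if pol then E \<subseteq> edges G else edges G \<subseteq> E)"
    proof
      assume ?pol
      then have p: "({x, y} \<in> edges G) = pol" if "({x, y} \<in> edges G) \<noteq> ({x, y} \<in> E)" for x y
        using that simple_graph_edgeD[OF G, of x y] simple_graph_edgeD[OF sE, of x y]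
        unfolding d by (auto simp: rel_of_def)
      show "if pol then E \<subseteq> edges G else edges G \<subseteq> E"
      proof -
        have "(e \<in> edges G) = pol" if e: "(e \<in> edges G) \<noteq> (e \<in> E)" for e
        proof -
          obtain x y where "e = {x, y}"
            using simple_graph_edge_pair[OF G, of e] simple_graph_edge_pair[OF sE, of e] e by auto
          then show ?thesis using p e by blast
        qed
        then show ?thesis by auto
      qed
    next
      assume "if pol then E \<subseteq> edges G else edges G \<subseteq> E"
      then show ?pol unfolding d using simple_graph_edgeD[OF sE]
        by (auto simp: rel_of_def split: if_splits)
    qed
    moreover have "(edges G - E) \<union> (E - edges G) = (if pol then edges G - E else E - edges G)"
      if "if pol then E \<subseteq> edges G else edges G \<subseteq> E"
      using that by (auto split: if_splits)
    ultimately show ?thesis unfolding diffs by (auto split: if_splits)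
  qed
  show ?thesis
  proof
    assume "edit_problem pol G k"
    then obtain E where E: "E \<subseteq> vertex_pairs ?V" "?R E" "trivially_perfect (Graph ?V E)"
      unfolding edit_problem_iff_supergraph[OF G] by blast
    have "solution pol (rel_of G) k (rel_of (Graph ?V E))"
      using key[OF E(1)] E(2,3) simp[OF E(1)] rgraph_rel_of[OF simp[OF E(1)]]
      unfolding solution_def trivially_perfect_iff_obs_free[OF simp[OF E(1)]]
      by (auto simp: rel_of_refl[OF G] rel_of_refl[OF simp[OF E(1)]])
    then show "solvable pol (rel_of G) k" by (auto simp: solvable_def)
  next
    assume "solvable pol (rel_of G) k"
    then obtain h where h: "solution pol (rel_of G) k h" by (auto simp: solvable_def)
    then have hg: "rgraph h" and hV: "\<And>x. h x x \<longleftrightarrow> x \<in> ?V"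
      by (auto simp: solution_def rel_of_refl[OF G])
    define E where "E = {{x, y} | x y. x \<noteq> y \<and> h x y}"
    have eq: "rel_of (Graph ?V E) = h" unfolding E_def using hg hV by (rule rel_of_graph_of_rel)
    have E: "E \<subseteq> vertex_pairs ?V"
      using simple_graph_of_rel[OF hg] by (simp add: simple_graph_def hV E_def)
    have "?R E" using key[OF E] h unfolding eq solution_def by blast
    moreover have "trivially_perfect (Graph ?V E)"
      using h unfolding trivially_perfect_iff_obs_free[OF simp[OF E]] eq solution_def by blast
    ultimately show "edit_problem pol G k"
      unfolding edit_problem_iff_supergraph[OF G] using E by blast
  qed
qed

lemma simple_graph_P4: "simple_graph P4"
  by (simp add: simple_graph_def P4_def vertex_pairs_def)

text \<open>With budget 0 the only candidate is \<open>P4\<close> itself.\<close>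

lemma not_edit_problem_P4: "\<not> edit_problem pol P4 0"
proof -
  have "obs (rel_of P4) 0 1 2 3" by (simp add: obs_def rel_of_def P4_def doubleton_eq_iff)
  then have no: "\<not> obs_free (rel_of P4)" by (auto simp: obs_free_def)
  have "\<not> solution pol (rel_of P4) 0 h" for h
  proof
    assume that: "solution pol (rel_of P4) 0 h"
    have "finite (diffs (rel_of P4) h)"
      using that rgraph_rel_of[OF simple_graph_P4] by (intro finite_diffs) (auto simp: solution_def)
    then have "diffs (rel_of P4) h = {}" using that by (simp add: solution_def)
    then have "h = rel_of P4" by (auto simp: diffs_def fun_eq_iff)
    then show False using that no by (simp add: solution_def)
  qed
  then show ?thesis
    unfolding edit_problem_iff_solvable[OF simple_graph_P4] solvable_def by simp
qed

section \<open>Programs with bounded loops\<close>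

text \<open>All loops run a fixed number \<open>N\<close> of rounds, so that both the effect of a
  program and a bound on its time are given by structural recursion, and termination is
  automatic.\<close>

datatype prog =
    Put nat aexp aexp
  | Then prog prog (infixr ";;" 60)
  | When aexp prog
  | For nat prog

abbreviation reg :: "nat \<Rightarrow> aexp" where
  "reg a \<equiv> Cell a (Num 0)"

definition upd :: "store \<Rightarrow> nat \<Rightarrow> nat \<Rightarrow> nat \<Rightarrow> store" where
  "upd s a i v = s(a := (s a)(i := v))"

lemma upd_apply [simp]: "upd s a i v b j = (if b = a \<and> j = i then v else s b j)"
  by (simp add: upd_def)

lemma exec_upd: "exec (Assign a i e) s (acost i + acost e + 1) (upd s a (aval i s) (aval e s))"
  unfolding upd_def by (rule exec_Assign)

lemma upd_upd [simp]: "upd (upd s a i v) a i w = upd s a i w"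
  by (simp add: upd_def)

text \<open>A loop writes \<open>j\<close> into its counter before round \<open>j\<close> and leaves
  \<open>N\<close> there, as the compiled while loop does when its body preserves the
  counter.\<close>

primrec run :: "nat \<Rightarrow> prog \<Rightarrow> store \<Rightarrow> store" where
  "run N (Put a i e) = (\<lambda>s. upd s a (aval i s) (aval e s))"
| "run N (p ;; q) = (\<lambda>s. run N q (run N p s))"
| "run N (When b p) = (\<lambda>s. if aval b s \<noteq> 0 then run N p s else s)"
| "run N (For x p) = (\<lambda>s. upd (fold (\<lambda>j s. run N p (upd s x 0 j)) [0..<N] s) x 0 N)"

primrec com_of :: "prog \<Rightarrow> com" where
  "com_of (Put a i e) = Assign a i e"
| "com_of (p ;; q) = Seq (com_of p) (com_of q)"
| "com_of (When b p) = Cond b (com_of p) Skip"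
| "com_of (For x p) = Seq (Assign x (Num 0) (Num 0))
     (While (Minus (reg 2) (reg x)) (Seq (com_of p) (Assign x (Num 0) (Plus (reg x) (Num 1)))))"

primrec writes :: "prog \<Rightarrow> nat set" where
  "writes (Put a i e) = {a}"
| "writes (p ;; q) = writes p \<union> writes q"
| "writes (When b p) = writes p"
| "writes (For x p) = insert x (writes p)"

text \<open>Loops run up to the value of \<open>reg 2\<close>; neither it nor a loop counter may change in a loop body.\<close>

primrec wf_prog :: "prog \<Rightarrow> bool" where
  "wf_prog (Put a i e) \<longleftrightarrow> a \<noteq> 2"
| "wf_prog (p ;; q) \<longleftrightarrow> wf_prog p \<and> wf_prog q"
| "wf_prog (When b p) \<longleftrightarrow> wf_prog p"
| "wf_prog (For x p) \<longleftrightarrow> wf_prog p \<and> x \<noteq> 2 \<and> x \<notin> writes p"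

text \<open>A round of \<open>For\<close> costs 6 steps for the test and 6 for the increment besides
  the body; 3 for the initialisation and 6 for the last test make up the 9.\<close>

primrec ptime :: "nat \<Rightarrow> prog \<Rightarrow> nat" where
  "ptime N (Put a i e) = acost i + acost e + 1"
| "ptime N (p ;; q) = ptime N p + ptime N q"
| "ptime N (When b p) = acost b + 2 + ptime N p"
| "ptime N (For x p) = N * (ptime N p + 12) + 9"

lemma run_frame: "a \<notin> writes p \<Longrightarrow> run N p s a = s a"
proof (induction p arbitrary: s)
  case (For x p)
  have "fold (\<lambda>j s. run N p (upd s x 0 j)) js s a = s a" for js
    using For by (induction js arbitrary: s) (auto simp: upd_def)
  then show ?case using For by (simp add: upd_def)
qed (auto simp: upd_def)

lemma wf_prog_writes: "wf_prog p \<Longrightarrow> 2 \<notin> writes p"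
  by (induction p) auto

lemma exec_com_of:
  assumes "wf_prog p" "s 2 0 = N"
  shows "\<exists>t \<le> ptime N p. exec (com_of p) s t (run N p s)"
  using assms
proof (induction p arbitrary: s)
  case (Put a i e)
  show ?case unfolding run.simps com_of.simps ptime.simps using exec_upd[of a i e s] by blast
next
  case (Then p q)
  have "run N p s 2 0 = N" using Then.prems run_frame[OF wf_prog_writes] by simp
  then obtain t1 t2 where "t1 \<le> ptime N p" "exec (com_of p) s t1 (run N p s)"
    "t2 \<le> ptime N q" "exec (com_of q) (run N p s) t2 (run N q (run N p s))"
    using Then.IH(1)[of s] Then.IH(2)[of "run N p s"] Then.prems by auto
  then show ?case using exec_Seq by (auto intro!: exI[of _ "t1 + t2"])
next
  case (When b p)
  then obtain t where t: "t \<le> ptime N p" "exec (com_of p) s t (run N p s)" by auto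
  show ?case
  proof (cases "aval b s = 0")
    case True
    then show ?thesis using exec_CondFalse[OF True exec_Skip]
      by (intro exI[of _ "acost b + 1 + 1"]) simp
  next
    case False
    then show ?thesis using exec_CondTrue[OF False t(2)] t(1)
      by (intro exI[of _ "acost b + 1 + t"]) simp
  qed
next
  case (For x p)
  let ?step = "\<lambda>j s. run N p (upd s x 0 j)"
  let ?b = "Minus (reg 2) (reg x)"
  let ?c = "Seq (com_of p) (Assign x (Num 0) (Plus (reg x) (Num 1)))"
  let ?T = "ptime N p"
  have x: "x \<noteq> 2" "x \<notin> writes p" "2 \<notin> writes p" "wf_prog p" using For.prems wf_prog_writes by auto
  \<comment> \<open>Induction on the number \<open>m\<close> of remaining rounds, with the counter
    at \<open>N - m\<close>; the 6 extra steps pay for the last test.\<close>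
  have loop: "\<exists>t \<le> m * (?T + 12) + 6.
      exec (While ?b ?c) s t (upd (fold ?step [N - m..<N] s) x 0 N)"
    if "m \<le> N" "s 2 0 = N" "s x 0 = N - m" for m s
    using that
  proof (induction m arbitrary: s)
    case 0
    have e: "upd s x 0 N = s" using 0 by (auto simp: fun_eq_iff)
    have "exec (While ?b ?c) s (acost ?b + 1) s"
      by (rule exec_WhileFalse) (use 0 in simp)
    then have "exec (While ?b ?c) s (acost ?b + 1) (upd (fold ?step [N - 0..<N] s) x 0 N)" using e by simp
    moreover have "acost ?b + 1 \<le> 0 * (?T + 12) + 6" by simp
    ultimately show ?case by blast
  next
    case (Suc m)
    let ?j = "N - Suc m"
    have sx: "upd s x 0 ?j = s" using Suc.prems by (auto simp: fun_eq_iff)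
    obtain t1 where t1: "t1 \<le> ?T" "exec (com_of p) s t1 (run N p s)"
      using For.IH[of s] x(4) Suc.prems(2) by auto
    let ?s1 = "run N p s"
    let ?s2 = "upd ?s1 x 0 (N - m)"
    have s1: "?s1 x = s x" "?s1 2 = s 2" using run_frame x by auto
    have e2: "exec (Assign x (Num 0) (Plus (reg x) (Num 1))) ?s1 6 ?s2"
      using exec_upd[of x "Num 0" "Plus (reg x) (Num 1)" ?s1] s1 Suc.prems
      by (simp add: Suc_diff_Suc eval_nat_numeral)
    have "m \<le> N" "?s2 2 0 = N" "?s2 x 0 = N - m" using s1 Suc.prems x by auto
    then obtain t2 where t2: "t2 \<le> m * (?T + 12) + 6"
      "exec (While ?b ?c) ?s2 t2 (upd (fold ?step [N - m..<N] ?s2) x 0 N)"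
      using Suc.IH[of ?s2] by blast
    \<comment> \<open>The next round overwrites the counter first, and after the last round the
      final update does; so the increment is invisible in \<open>run\<close>.\<close>
    have "fold ?step [N - m..<N] ?s2 = fold ?step [N - m..<N] ?s1" if "m > 0"
      using that Suc.prems by (simp add: upt_rec[of "N - m" N])
    then have "upd (fold ?step [N - m..<N] ?s2) x 0 N = upd (fold ?step [N - m..<N] ?s1) x 0 N"
      by (cases "m = 0") auto
    moreover have "[?j..<N] = ?j # [N - m..<N]"
      using Suc.prems by (simp add: upt_rec[of ?j N] Suc_diff_Suc)
    ultimately have fin: "upd (fold ?step [N - m..<N] ?s2) x 0 N = upd (fold ?step [?j..<N] s) x 0 N"
      using sx by simp
    have "exec (While ?b ?c) s (acost ?b + 1 + (t1 + 6) + t2) (upd (fold ?step [?j..<N] s) x 0 N)"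
      by (rule exec_WhileTrue[OF _ exec_Seq[OF t1(2) e2] t2(2)[unfolded fin]])
        (use Suc.prems in simp)
    moreover have "acost ?b + 1 + (t1 + 6) + t2 \<le> Suc m * (?T + 12) + 6" using t1 t2 by simp
    ultimately show ?case by blast
  qed
  let ?s0 = "upd s x 0 0"
  have "N \<le> N" "?s0 2 0 = N" "?s0 x 0 = 0" using For.prems by auto
  then obtain t where t: "t \<le> N * (?T + 12) + 6"
    "exec (While ?b ?c) ?s0 t (upd (fold ?step [0..<N] ?s0) x 0 N)"
    using loop[of N ?s0, unfolded diff_self_eq_0] by blast
  have "fold ?step [0..<N] ?s0 = fold ?step [0..<N] s" if "N > 0"
    using that by (simp add: upt_rec[of 0 N])
  then have eq: "upd (fold ?step [0..<N] ?s0) x 0 N = run N (For x p) s"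
    by (cases "N = 0") auto
  have "exec (Assign x (Num 0) (Num 0)) s 3 ?s0"
    using exec_upd[of x "Num 0" "Num 0" s] by (simp add: eval_nat_numeral)
  from exec_Seq[OF this t(2)[unfolded eq]]
  have "exec (com_of (For x p)) s (3 + t) (run N (For x p) s)" by simp
  moreover have "3 + t \<le> ptime N (For x p)" using t(1) by simp
  ultimately show ?case by blast
qed

lemma run_For_induct:
  assumes "I 0 s" and "\<And>j s. j < N \<Longrightarrow> I j s \<Longrightarrow> I (Suc j) (run N p (upd s x 0 j))"
    and "\<And>s. I N s \<Longrightarrow> Q (upd s x 0 N)"
  shows "Q (run N (For x p) s)"
proof -
  have "I m (fold (\<lambda>j s. run N p (upd s x 0 j)) [0..<m] s)" if "m \<le> N" for m
    using that by (induction m) (use assms in auto)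
  then show ?thesis using assms(3) by simp
qed

text \<open>The number of rounds is the number of vertices, so time bounds are polynomials in
  \<open>n\<close>, embedded here into the bivariate ones.\<close>

definition polynomial_fun :: "(nat \<Rightarrow> nat) \<Rightarrow> bool" where
  "polynomial_fun f \<longleftrightarrow> (\<exists>p :: nat poly poly. \<forall>n k. poly (poly p [:n:]) k = f n)"

lemma polynomial_fun_const: "polynomial_fun (\<lambda>n. c)"
  unfolding polynomial_fun_def by (rule exI[of _ "[:[:c:]:]"]) simp

lemma polynomial_fun_id: "polynomial_fun (\<lambda>n. n)"
  unfolding polynomial_fun_def by (rule exI[of _ "[:0, 1:]"]) simp

lemma polynomial_fun_add: "polynomial_fun f \<Longrightarrow> polynomial_fun g \<Longrightarrow> polynomial_fun (\<lambda>n. f n + g n)"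
  unfolding polynomial_fun_def by (metis poly_add)

lemma polynomial_fun_mult: "polynomial_fun f \<Longrightarrow> polynomial_fun g \<Longrightarrow> polynomial_fun (\<lambda>n. f n * g n)"
  unfolding polynomial_fun_def by (metis poly_mult)

lemmas polynomial_fun_intros =
  polynomial_fun_const polynomial_fun_id polynomial_fun_add polynomial_fun_mult

lemma polynomial_fun_ptime: "polynomial_fun (\<lambda>N. ptime N p)"
  by (induction p) (unfold ptime.simps, (intro polynomial_fun_intros; assumption)+)

section \<open>First-order formulas with counting\<close>

text \<open>The conditions of both rules are formulas of this logic, so one compiler to nested loops
  provides the tests for both; \<open>Many_of\<close> counts against the common threshold
  \<open>2 k + 1\<close>.\<close>

datatype fm = Adj nat nat | Neg fm | Conj fm fm | Some_of fm | Many_of fm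

text \<open>A quantifier at level \<open>l\<close> binds the variable \<open>l\<close>, whose value the program below keeps in array \<open>var l\<close>.\<close>

primrec sat :: "(nat \<Rightarrow> nat \<Rightarrow> bool) \<Rightarrow> nat \<Rightarrow> nat \<Rightarrow> nat \<Rightarrow> (nat \<Rightarrow> nat) \<Rightarrow> fm \<Rightarrow> bool" where
  "sat r k N l v (Adj x y) = r (v x) (v y)"
| "sat r k N l v (Neg f) = (\<not> sat r k N l v f)"
| "sat r k N l v (Conj f g) = (sat r k N l v f \<and> sat r k N l v g)"
| "sat r k N l v (Some_of f) = (\<exists>j<N. sat r k N (Suc l) (v(l := j)) f)"
| "sat r k N l v (Many_of f) = (card {j. j < N \<and> sat r k N (Suc l) (v(l := j)) f} > 2 * k + 1)"

primrec closed_at :: "nat \<Rightarrow> fm \<Rightarrow> bool" where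
  "closed_at l (Adj x y) \<longleftrightarrow> x < l \<and> y < l"
| "closed_at l (Neg f) \<longleftrightarrow> closed_at l f"
| "closed_at l (Conj f g) \<longleftrightarrow> closed_at l f \<and> closed_at l g"
| "closed_at l (Some_of f) \<longleftrightarrow> closed_at (Suc l) f"
| "closed_at l (Many_of f) \<longleftrightarrow> closed_at (Suc l) f"

text \<open>Variables and results are interleaved from 20 on: a test at level \<open>l\<close>
  writes only arrays from \<open>var l\<close> on, which spares the outer levels and all arrays
  below 20.\<close>

definition var :: "nat \<Rightarrow> nat" where "var l = 20 + 2 * l"
definition val :: "nat \<Rightarrow> nat" where "val l = 21 + 2 * l"

abbreviation entry :: "aexp \<Rightarrow> aexp \<Rightarrow> aexp" where
  "entry x y \<equiv> Plus (Cell 4 x) y"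

text \<open>Truth is a nonzero value: truncated subtraction of \<open>e\<close> leaves one exactly
  if more than \<open>e\<close> indices pass.\<close>

definition count_prog :: "nat \<Rightarrow> prog \<Rightarrow> aexp \<Rightarrow> prog" where
  "count_prog l p e = Put (val l) (Num 0) (Num 0) ;;
     For (var l) (p ;; When (reg (val (Suc l))) (Put (val l) (Num 0) (Plus (reg (val l)) (Num 1)))) ;;
     Put (val l) (Num 0) (Minus (reg (val l)) e)"

primrec test :: "nat \<Rightarrow> fm \<Rightarrow> prog" where
  "test l (Adj x y) = Put (val l) (Num 0) (Cell 3 (entry (reg (var x)) (reg (var y))))"
| "test l (Neg f) = test l f ;; Put (val l) (Num 0) (Minus (Num 1) (reg (val l)))"
| "test l (Conj f g) = test l f ;; When (reg (val l)) (test l g)"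
| "test l (Some_of f) = count_prog l (test (Suc l) f) (Num 0)"
| "test l (Many_of f) = count_prog l (test (Suc l) f)
     (Plus (Plus (Cell 0 (Num 1)) (Cell 0 (Num 1))) (Num 1))"

text \<open>Array 3 holds the matrix of the relation, so its diagonal marks the remaining vertices; array 4 holds the
  offsets of its rows, since multiplication is not available.\<close>

definition represents :: "nat \<Rightarrow> (nat \<Rightarrow> nat \<Rightarrow> bool) \<Rightarrow> nat \<Rightarrow> store \<Rightarrow> bool" where
  "represents N r k s \<longleftrightarrow> s 0 1 = k \<and> s 2 0 = N \<and> (\<forall>i<N. s 4 i = i * N) \<and>
     (\<forall>i<N. \<forall>j<N. s 3 (i * N + j) = of_bool (r i j))"

lemma represents_cong:
  "s 0 = s' 0 \<Longrightarrow> s 2 = s' 2 \<Longrightarrow> s 3 = s' 3 \<Longrightarrow> s 4 = s' 4 \<Longrightarrow> represents N r k s \<longleftrightarrow> represents N r k s'"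
  by (simp add: represents_def)

lemma writes_test: "a \<in> writes (test l f) \<Longrightarrow> var l \<le> a"
  by (induction f arbitrary: l) (auto simp: count_prog_def var_def val_def dest!: Suc_leD, force+)

lemma wf_prog_test: "wf_prog (test l f)"
proof (induction f arbitrary: l)
  case (Some_of f)
  then show ?case using writes_test[of "var l" "Suc l" f] by (auto simp: count_prog_def var_def val_def)
next
  case (Many_of f)
  then show ?case using writes_test[of "var l" "Suc l" f] by (auto simp: count_prog_def var_def val_def)
qed (auto simp: var_def val_def)

lemma run_test_frame: "a < var l \<Longrightarrow> run N (test l f) s a = s a"
  by (rule run_frame) (use writes_test in force)

lemma card_less_Suc_if:
  "card {j. j < Suc m \<and> P j} = card {j. j < m \<and> P j} + of_bool (P m)"
proof -
  have "{j. j < Suc m \<and> P j} = {j. j < m \<and> P j} \<union> (if P m then {m} else {})"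
    by (auto simp: less_Suc_eq)
  then show ?thesis by auto
qed

text \<open>The hypothesis \<open>body\<close> relies on the counter and the arrays below
  \<open>var l\<close> only, since earlier rounds may leave anything in the arrays of inner
  levels.\<close>

lemma run_count_prog:
  assumes body: "\<And>j s'. j < N \<Longrightarrow> s' (var l) 0 = j \<Longrightarrow> (\<And>a. a < var l \<Longrightarrow> s' a = s a) \<Longrightarrow>
      (run N p s' (val (Suc l)) 0 \<noteq> 0 \<longleftrightarrow> P j)"
    and frame: "\<And>a. a \<in> writes p \<Longrightarrow> var (Suc l) \<le> a"
    and e: "\<And>s'. (\<And>a. a < var l \<Longrightarrow> s' a = s a) \<Longrightarrow> aval e s' = c"
  shows "run N (count_prog l p e) s (val l) 0 = card {j. j < N \<and> P j} - c"
proof -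
  let ?b = "p ;; When (reg (val (Suc l))) (Put (val l) (Num 0) (Plus (reg (val l)) (Num 1)))"
  let ?I = "\<lambda>j s'. (\<forall>a<var l. s' a = s a) \<and> s' (val l) 0 = card {i. i < j \<and> P i}"
  have nw: "a \<notin> writes p" if "a < var l \<or> a = var l \<or> a = val l" for a
    using frame[of a] that by (auto simp: var_def val_def)
  have "?I N (run N (For (var l) ?b) (upd s (val l) 0 0))"
  proof (rule run_For_induct[where I = ?I])
    show "?I 0 (upd s (val l) 0 0)" by (auto simp: upd_def val_def var_def)
  next
    fix j s' assume j: "j < N" and I: "?I j s'"
    let ?u = "upd s' (var l) 0 j"
    have u: "\<And>a. a < var l \<Longrightarrow> ?u a = s a" using I by (auto simp: upd_def)
    have P: "run N p ?u (val (Suc l)) 0 \<noteq> 0 \<longleftrightarrow> P j" using body[OF j _ u] by auto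
    have fr: "run N p ?u a = ?u a" if "a < var l \<or> a = val l" for a
      using run_frame nw that by blast
    have "val l \<noteq> var l" by (simp add: val_def var_def)
    then show "?I (Suc j) (run N ?b ?u)"
      using P fr I u by (auto simp: card_less_Suc_if upd_def val_def var_def)
  next
    show "?I N (upd s' (var l) 0 N)" if "?I N s'" for s'
      using that by (auto simp: upd_def val_def var_def)
  qed
  then show ?thesis using e by (simp add: count_prog_def)
qed

text \<open>The matrix and the values of outer variables lie below \<open>var l\<close>, so they
  survive the tests of subformulas; quantifiers are instances of
  \<open>run_count_prog\<close>.\<close>

lemma run_test:
  assumes "represents N r k s" "closed_at l f" "\<And>x. x < l \<Longrightarrow> s (var x) 0 = v x \<and> v x < N"
  shows "run N (test l f) s (val l) 0 \<noteq> 0 \<longleftrightarrow> sat r k N l v f"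
  using assms
proof (induction f arbitrary: l s v)
  case (Adj x y)
  then have "s 4 (v x) = v x * N" "s 3 (v x * N + v y) = of_bool (r (v x) (v y))"
    by (auto simp: represents_def)
  then show ?case using Adj by simp
next
  case (Neg f)
  have "run N (test l f) s (val l) 0 \<noteq> 0 \<longleftrightarrow> sat r k N l v f"
    by (rule Neg.IH) (use Neg.prems in auto)
  then show ?case by auto
next
  case (Conj f g)
  let ?s = "run N (test l f) s"
  have fr: "?s a = s a" if "a < var l" for a using that by (rule run_test_frame)
  have "represents N r k ?s"
    using Conj.prems(1) fr by (subst represents_cong[of _ s]) (auto simp: var_def)
  moreover have "?s (var x) 0 = v x \<and> v x < N" if "x < l" for x
    using that fr[of "var x"] Conj.prems(3) by (auto simp: var_def)
  ultimately have "run N (test l g) ?s (val l) 0 \<noteq> 0 \<longleftrightarrow> sat r k N l v g"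
    using Conj.prems(2) by (intro Conj.IH(2)) auto
  moreover have "?s (val l) 0 \<noteq> 0 \<longleftrightarrow> sat r k N l v f"
    by (rule Conj.IH(1)) (use Conj.prems in auto)
  ultimately show ?case by auto
next
  case (Some_of f)
  have body: "run N (test (Suc l) f) s' (val (Suc l)) 0 \<noteq> 0 \<longleftrightarrow> sat r k N (Suc l) (v(l := j)) f"
    if "j < N" "s' (var l) 0 = j" "\<And>a. a < var l \<Longrightarrow> s' a = s a" for j s'
  proof (rule Some_of.IH)
    show "represents N r k s'"
      using Some_of.prems(1) that(3) by (subst represents_cong[of _ s]) (auto simp: var_def)
    show "closed_at (Suc l) f" using Some_of.prems by simp
    show "s' (var x) 0 = (v(l := j)) x \<and> (v(l := j)) x < N" if "x < Suc l" for x
      using Some_of.prems(3)[of x] that \<open>j < N\<close> \<open>s' (var l) 0 = j\<close> \<open>\<And>a. a < var l \<Longrightarrow> s' a = s a\<close>[of "var x"]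
      by (cases "x = l") (auto simp: var_def)
  qed
  have "run N (test l (Some_of f)) s (val l) 0 = card {j. j < N \<and> sat r k N (Suc l) (v(l := j)) f} - 0"
    unfolding test.simps by (rule run_count_prog) (use body writes_test in auto)
  then show ?case by auto
next
  case (Many_of f)
  have body: "run N (test (Suc l) f) s' (val (Suc l)) 0 \<noteq> 0 \<longleftrightarrow> sat r k N (Suc l) (v(l := j)) f"
    if "j < N" "s' (var l) 0 = j" "\<And>a. a < var l \<Longrightarrow> s' a = s a" for j s'
  proof (rule Many_of.IH)
    show "represents N r k s'"
      using Many_of.prems(1) that(3) by (subst represents_cong[of _ s]) (auto simp: var_def)
    show "closed_at (Suc l) f" using Many_of.prems by simp
    show "s' (var x) 0 = (v(l := j)) x \<and> (v(l := j)) x < N" if "x < Suc l" for x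
      using Many_of.prems(3)[of x] that \<open>j < N\<close> \<open>s' (var l) 0 = j\<close> \<open>\<And>a. a < var l \<Longrightarrow> s' a = s a\<close>[of "var x"]
      by (cases "x = l") (auto simp: var_def)
  qed
  have "run N (test l (Many_of f)) s (val l) 0 = card {j. j < N \<and> sat r k N (Suc l) (v(l := j)) f} - (2 * k + 1)"
    unfolding test.simps
  proof (rule run_count_prog)
    fix s' assume "\<And>a. a < var l \<Longrightarrow> s' a = s a"
    from this[of 0] show "aval (Plus (Plus (Cell 0 (Num 1)) (Cell 0 (Num 1))) (Num 1)) s' = 2 * k + 1"
      using Many_of.prems(1) by (simp add: represents_def var_def)
  qed (use body writes_test in auto)
  then show ?case by auto
qed

section \<open>The kernelization\<close>

definition nbr_le_fm :: "nat \<Rightarrow> nat \<Rightarrow> nat \<Rightarrow> fm" where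
  "nbr_le_fm l x u = Neg (Some_of (Conj (Adj x l) (Neg (Adj u l))))"

definition inner_fm :: "nat \<Rightarrow> nat \<Rightarrow> fm" where
  "inner_fm l x = Some_of (Some_of (Some_of (Conj (Adj l x) (Conj (Adj x (l + 1))
     (Conj (Adj (l + 1) (l + 2)) (Conj (Neg (Adj l (l + 1))) (Neg (Adj x (l + 2)))))))))"

definition above_fm :: "nat \<Rightarrow> nat \<Rightarrow> nat \<Rightarrow> fm" where
  "above_fm l x w = Conj (Adj x w) (Neg (nbr_le_fm l w x))"

definition same_above_fm :: "nat \<Rightarrow> nat \<Rightarrow> nat \<Rightarrow> fm" where
  "same_above_fm l x y = Conj
     (Neg (Some_of (Conj (above_fm (Suc l) x l) (Neg (above_fm (Suc l) y l)))))
     (Neg (Some_of (Conj (above_fm (Suc l) y l) (Neg (above_fm (Suc l) x l)))))"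

text \<open>Variable 0 is the tested vertex; inside the counting quantifier, variable 1 is the
  candidate member of its module and variable 2 the witness \<open>u\<close> of
  \<open>below\<close>.\<close>

definition removable_fm :: fm where
  "removable_fm = Conj (Adj 0 0) (Conj (Neg (inner_fm 1 0)) (Many_of (Conj (Adj 1 1)
     (Some_of (Conj (Adj 2 2) (Conj (Neg (inner_fm 3 2)) (Conj (nbr_le_fm 3 1 2) (same_above_fm 3 2 0))))))))"

text \<open>Variables 0 and 1 are \<open>p\<close> and \<open>q\<close>, variable 2 is the counted
  vertex and variable 3 its witness \<open>d\<close>.\<close>

definition forced_fm :: "bool \<Rightarrow> fm" where
  "forced_fm pol = Conj (Adj 0 0) (Conj (Adj 1 1)
    (if pol then Conj (Adj 0 1) (Neg (Conj
       (Neg (Many_of (Conj (Adj 1 2) (Conj (Neg (Adj 0 2)) (Some_of (Conj (Adj 2 3) (Neg (Adj 1 3))))))))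
       (Neg (Conj (Many_of (Conj (Adj 2 0) (Neg (Adj 2 1)))) (Many_of (Conj (Adj 1 2) (Neg (Adj 0 2))))))))
     else Conj (Neg (Adj 0 1))
       (Many_of (Conj (Adj 0 2) (Conj (Adj 2 1) (Some_of (Conj (Adj 1 3) (Neg (Adj 2 3)))))))))"

text \<open>Formulas quantify over indices below \<open>N\<close>, the rules over all numbers;
  \<open>dom\<close> reconciles the two.\<close>

context
  fixes r :: "nat \<Rightarrow> nat \<Rightarrow> bool" and N :: nat
  assumes dom: "\<And>x y. r x y \<Longrightarrow> x < N \<and> y < N"
begin

lemma sat_nbr_le_fm:
  "x < l \<Longrightarrow> u < l \<Longrightarrow> sat r k N l v (nbr_le_fm l x u) \<longleftrightarrow> nbr_le r (v x) (v u)"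
  using dom by (auto simp: nbr_le_fm_def nbr_le_def)

lemma sat_inner_fm: "x < l \<Longrightarrow> sat r k N l v (inner_fm l x) \<longleftrightarrow> inner r (v x)"
  using dom by (auto simp: inner_fm_def inner_def obs_def) blast

lemma sat_above_fm:
  "x < l \<Longrightarrow> w < l \<Longrightarrow> sat r k N l v (above_fm l x w) \<longleftrightarrow> v w \<in> above r (v x)"
  by (simp add: above_fm_def sat_nbr_le_fm above_def)

lemma sat_same_above_fm:
  assumes "x < l" "y < l"
  shows "sat r k N l v (same_above_fm l x y) \<longleftrightarrow> above r (v x) = above r (v y)"
proof -
  have "w < N" if "w \<in> above r z" for w z using that dom by (auto simp: above_def)
  then show ?thesis using assms by (auto simp: same_above_fm_def sat_above_fm)
qed

lemma sat_removable_fm: "sat r k N 1 v removable_fm \<longleftrightarrow> removable r k (v 0)"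
proof -
  have "{j. j < N \<and> r j j \<and> (\<exists>u<N. r u u \<and> \<not> inner r u \<and> nbr_le r j u \<and> above r u = above r (v 0))}
      = below r (above r (v 0))"
    using dom by (auto simp: below_def)
  then show ?thesis
    by (simp add: removable_fm_def removable_def sat_inner_fm sat_nbr_le_fm sat_same_above_fm
        eval_nat_numeral)
qed

lemma sat_forced_fm: "sat r k N 2 v (forced_fm pol) \<longleftrightarrow> forced pol r k (v 0) (v 1)"
proof -
  let ?p = "v 0" and ?q = "v 1"
  have "{j. j < N \<and> r ?q j \<and> \<not> r ?p j \<and> (\<exists>d<N. r j d \<and> \<not> r ?q d)}
      = {j. r ?q j \<and> \<not> r ?p j \<and> (\<exists>d. r j d \<and> \<not> r ?q d)}"
    "{j. j < N \<and> r j ?p \<and> \<not> r j ?q} = {j. r j ?p \<and> \<not> r j ?q}"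
    "{j. j < N \<and> r ?q j \<and> \<not> r ?p j} = {j. r ?q j \<and> \<not> r ?p j}"
    "{j. j < N \<and> r ?p j \<and> r j ?q \<and> (\<exists>d<N. r ?q d \<and> \<not> r j d)}
      = {j. r ?p j \<and> r j ?q \<and> (\<exists>d. r ?q d \<and> \<not> r j d)}"
    using dom by blast+
  then show ?thesis
    by (simp add: forced_fm_def forced_def eval_nat_numeral)
qed

end

lemma closed_at_fms:
  "closed_at 1 removable_fm" "closed_at 2 (forced_fm pol)"
  by (auto simp: removable_fm_def forced_fm_def inner_fm_def nbr_le_fm_def same_above_fm_def above_fm_def)

section \<open>Programs that apply the rules\<close>

definition flip_prog :: prog where
  "flip_prog =
     Put 3 (entry (reg (var 0)) (reg (var 1))) (Minus (Num 1) (Cell 3 (entry (reg (var 0)) (reg (var 1))))) ;;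
     Put 3 (entry (reg (var 1)) (reg (var 0))) (Minus (Num 1) (Cell 3 (entry (reg (var 1)) (reg (var 0))))) ;;
     Put 0 (Num 1) (Minus (Cell 0 (Num 1)) (Num 1))"

definition try_flip :: "bool \<Rightarrow> prog" where
  "try_flip pol = test 2 (forced_fm pol) ;; When (reg (val 2)) (When (Cell 0 (Num 1)) flip_prog)"

definition delete_prog :: prog where
  "delete_prog = For 10 (Put 3 (entry (reg (var 0)) (reg 10)) (Num 0) ;;
     Put 3 (entry (reg 10) (reg (var 0))) (Num 0))"

definition try_delete :: prog where
  "try_delete = test 1 removable_fm ;; When (reg (val 1)) delete_prog"

text \<open>The two outer loops merely count \<open>N * N\<close> rounds; this is the largest size
  of \<open>editable\<close>, which shrinks in every round that starts unreduced.\<close>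

definition reduce_prog :: "bool \<Rightarrow> prog" where
  "reduce_prog pol = For 8 (For 9 (For (var 0) (For (var 1) (try_flip pol)) ;; For (var 0) try_delete))"

lemma index_eq_iff:
  assumes "j < N" "j' < N"
  shows "i * N + j = i' * N + j' \<longleftrightarrow> i = i' \<and> j = (j'::nat)"
proof
  assume eq: "i * N + j = i' * N + j'"
  have "(i * N + j) div N = i" "(i' * N + j') div N = i'" using assms by auto
  then show "i = i' \<and> j = j'" using eq by auto
qed auto

lemma not_in_writes_test [simp]: "a < 20 \<Longrightarrow> a \<notin> writes (test l f)"
  using writes_test[of a l f] by (auto simp: var_def)

lemma represents_flip_prog:
  assumes s: "represents N r k s" and pq: "s (var 0) 0 = p" "s (var 1) 0 = q" "p < N" "q < N" "p \<noteq> q"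
  shows "represents N (flip_pair r p q) (k - 1) (run N flip_prog s)"
proof -
  \<comment> \<open>The two entries are different cells, so the second assignment does not undo the
    first.\<close>
  have ne: "p * N + q \<noteq> q * N + p" using pq by (simp add: index_eq_iff)
  have v: "var 0 = 20" "var 1 = 22" by (simp_all add: var_def)
  have "of_bool (flip_pair r p q i j) = (if i * N + j = p * N + q \<or> i * N + j = q * N + p
      then 1 - of_bool (r i j) else (of_bool (r i j) :: nat))" if "i < N" "j < N" for i j
    using that pq by (auto simp: index_eq_iff flip_pair_def doubleton_eq_iff)
  then show ?thesis
    using s pq ne unfolding represents_def flip_prog_def v
    by (auto simp: index_eq_iff)
qed

lemma represents_delete_prog:
  assumes s: "represents N r k s" and v: "s (var 0) 0 = v" "v < N"
  shows "represents N (del_vertex r v) k (run N delete_prog s)"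
proof -
  let ?r = "\<lambda>z x y. r x y \<and> \<not> (x = v \<and> y < z) \<and> \<not> (y = v \<and> x < z)"
  let ?I = "\<lambda>z s. represents N (?r z) k s \<and> s (var 0) 0 = v"
  have w: "var 0 = 20" by (simp add: var_def)
  have "represents N (?r N) k (run N delete_prog s)"
    unfolding delete_prog_def
  proof (rule run_For_induct[where I = ?I])
    show "?I 0 s" using s v by simp
  next
    fix j s' assume "j < N" "?I j s'"
    then show "?I (Suc j) (run N (Put 3 (entry (reg (var 0)) (reg 10)) (Num 0) ;;
        Put 3 (entry (reg 10) (reg (var 0))) (Num 0)) (upd s' 10 0 j))"
      using v(2) by (auto simp: represents_def w index_eq_iff less_Suc_eq)
  next
    fix s' assume "?I N s'"
    then show "represents N (?r N) k (upd s' 10 0 N)" by (simp add: represents_def)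
  qed
  then show ?thesis
    by (simp add: represents_def del_vertex_def)
qed

section \<open>Exhaustive application of the rules\<close>

text \<open>The matrix keeps its size \<open>N\<close> throughout; a deleted vertex only leaves the
  diagonal.\<close>

definition stage :: "nat \<Rightarrow> bool \<Rightarrow> (nat \<Rightarrow> nat \<Rightarrow> bool) \<Rightarrow> nat \<Rightarrow> (nat \<Rightarrow> nat \<Rightarrow> bool) \<Rightarrow> nat \<Rightarrow> bool" where
  "stage N pol r0 k0 r k \<longleftrightarrow> rgraph r \<and> (\<forall>x y. r x y \<longrightarrow> x < N \<and> y < N) \<and> k \<le> k0 \<and>
     (solvable pol r k \<longleftrightarrow> solvable pol r0 k0)"

text \<open>Every application of a rule shrinks this set; its diagonal accounts for the vertices.\<close>

definition editable :: "bool \<Rightarrow> (nat \<Rightarrow> nat \<Rightarrow> bool) \<Rightarrow> (nat \<times> nat) set" where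
  "editable pol r = {(p, q). r p p \<and> r q q \<and> (p \<noteq> q \<longrightarrow> r p q = pol)}"

lemma card_editable:
  assumes "stage N pol r0 k0 r k"
  shows "finite (editable pol r)" "card (editable pol r) \<le> N * N"
proof -
  have sub: "editable pol r \<subseteq> {..<N} \<times> {..<N}" using assms by (auto simp: editable_def stage_def)
  then show "finite (editable pol r)" by (rule finite_subset) simp
  show "card (editable pol r) \<le> N * N" using card_mono[OF _ sub] by simp
qed

lemma stage_flip_pair:
  assumes st: "stage N pol r0 k0 r k" and k: "k > 0" and f: "forced pol r k p q"
  shows "stage N pol r0 k0 (flip_pair r p q) (k - 1)"
    "card (editable pol (flip_pair r p q)) < card (editable pol r)"
proof -
  have r: "rgraph r" using st by (simp add: stage_def)
  note fd = forcedD[OF r f]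
  show "stage N pol r0 k0 (flip_pair r p q) (k - 1)"
    using st rgraph_flip_pair[OF r fd(1,3,4)] solvable_flip_pair[of r p q pol k] r fd(1,2) k fd(5) fd(3,4)
    by (auto simp: stage_def flip_pair_def doubleton_eq_iff split: if_splits)
  have "editable pol (flip_pair r p q) \<subset> editable pol r"
  proof
    show "editable pol (flip_pair r p q) \<subseteq> editable pol r"
      using fd rgraph_sym[OF r, of p q]
      by (auto simp: editable_def flip_pair_refl) (auto simp: flip_pair_def doubleton_eq_iff split: if_splits)
    have "(p, q) \<in> editable pol r" "(p, q) \<notin> editable pol (flip_pair r p q)"
      using fd by (auto simp: editable_def flip_pair_refl) (auto simp: flip_pair_def)
    then show "editable pol (flip_pair r p q) \<noteq> editable pol r" by blast
  qed
  then show "card (editable pol (flip_pair r p q)) < card (editable pol r)"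
    using card_editable(1)[OF st] by (rule psubset_card_mono[rotated])
qed

lemma stage_del_vertex:
  assumes st: "stage N pol r0 k0 r k" and f: "removable r k v"
  shows "stage N pol r0 k0 (del_vertex r v) k"
    "card (editable pol (del_vertex r v)) < card (editable pol r)"
proof -
  have r: "rgraph r" using st by (simp add: stage_def)
  show "stage N pol r0 k0 (del_vertex r v) k"
    using st rgraph_del_vertex[OF r] solvable_del_vertex[OF r f, of pol]
    by (auto simp: stage_def del_vertex_def)
  have "(v, v) \<in> editable pol r" using f by (auto simp: editable_def removable_def)
  moreover have "(v, v) \<notin> editable pol (del_vertex r v)" "editable pol (del_vertex r v) \<subseteq> editable pol r"
    by (auto simp: editable_def del_vertex_def)
  ultimately have "editable pol (del_vertex r v) \<subset> editable pol r" by blast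
  then show "card (editable pol (del_vertex r v)) < card (editable pol r)"
    using card_editable(1)[OF st] by (rule psubset_card_mono[rotated])
qed

text \<open>The invariant within a round that starts with \<open>r\<close> and \<open>k\<close>.
  Either nothing has changed, and \<open>B\<close> records the tests that have failed so far, or
  some rule was applied; then the measure has dropped and the start was not reduced.\<close>

definition progress where
  "progress N pol r0 k0 r k B s \<longleftrightarrow> (\<exists>r' k'. represents N r' k' s \<and> stage N pol r0 k0 r' k' \<and>
     (r' = r \<and> k' = k \<and> B \<or> card (editable pol r') < card (editable pol r) \<and> \<not> reduced pol r k))"

lemma progress_cong:
  "s 0 = s' 0 \<Longrightarrow> s 2 = s' 2 \<Longrightarrow> s 3 = s' 3 \<Longrightarrow> s 4 = s' 4 \<Longrightarrow>
    progress N pol r0 k0 r k B s \<longleftrightarrow> progress N pol r0 k0 r k B s'"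
  using represents_cong[of s s'] by (simp add: progress_def)

text \<open>A rule applied in the first alternative witnesses that the start was not reduced; in the
  second, it shrinks the measure further. A failed test is added to \<open>B\<close>.\<close>

lemma progress_try_flip:
  assumes s: "progress N pol r0 k0 r k B s" and pq: "s (var 0) 0 = p" "s (var 1) 0 = q" "p < N" "q < N"
  shows "progress N pol r0 k0 r k (B \<and> \<not> (k > 0 \<and> forced pol r k p q)) (run N (try_flip pol) s)"
proof -
  from s obtain r' k' where s': "represents N r' k' s" and st: "stage N pol r0 k0 r' k'"
    and alt: "r' = r \<and> k' = k \<and> B \<or> card (editable pol r') < card (editable pol r) \<and> \<not> reduced pol r k"
    by (auto simp: progress_def)
  let ?t = "run N (test 2 (forced_fm pol)) s"
  have fr: "?t a = s a" if "a < var 2" for a using that by (rule run_test_frame)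
  have dom: "\<And>x y. r' x y \<Longrightarrow> x < N \<and> y < N" using st by (simp add: stage_def)
  have "\<And>x. x < 2 \<Longrightarrow> s (var x) 0 = (\<lambda>x. if x = 0 then p else q) x \<and> (\<lambda>x. if x = 0 then p else q) x < N"
    using pq by (auto simp: less_2_cases_iff)
  from run_test[OF s' closed_at_fms(2) this]
  have t: "?t (val 2) 0 \<noteq> 0 \<longleftrightarrow> forced pol r' k' p q"
    using sat_forced_fm[of r' N k' "\<lambda>x. if x = 0 then p else q" pol] dom by auto
  have tr: "represents N r' k' ?t"
    using s' fr by (subst represents_cong[of _ s]) (auto simp: var_def)
  have tk: "?t 0 1 = k'" using tr by (simp add: represents_def)
  have tv: "?t (var 0) 0 = p" "?t (var 1) 0 = q" using fr pq by (auto simp: var_def)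
  show ?thesis
  proof (cases "forced pol r' k' p q \<and> k' > 0")
    case True
    then have run: "run N (try_flip pol) s = run N flip_prog ?t" using t tk by (simp add: try_flip_def)
    have "p \<noteq> q" using forcedD(1)[of r' pol k' p q] True st by (simp add: stage_def)
    then have "represents N (flip_pair r' p q) (k' - 1) (run N flip_prog ?t)"
      using represents_flip_prog[OF tr tv pq(3,4)] by simp
    moreover have "card (editable pol (flip_pair r' p q)) < card (editable pol r) \<and> \<not> reduced pol r k"
      using stage_flip_pair(2)[OF st, of p q] True alt by (auto simp: reduced_def)
    ultimately show ?thesis
      unfolding progress_def run using stage_flip_pair(1)[OF st] True by blast
  next
    case False
    then have "run N (try_flip pol) s = ?t" using t tk by (auto simp: try_flip_def)
    then show ?thesis unfolding progress_def using tr st alt False by auto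
  qed
qed

lemma progress_try_delete:
  assumes s: "progress N pol r0 k0 r k B s" and v: "s (var 0) 0 = v" "v < N"
  shows "progress N pol r0 k0 r k (B \<and> \<not> removable r k v) (run N try_delete s)"
proof -
  from s obtain r' k' where s': "represents N r' k' s" and st: "stage N pol r0 k0 r' k'"
    and alt: "r' = r \<and> k' = k \<and> B \<or> card (editable pol r') < card (editable pol r) \<and> \<not> reduced pol r k"
    by (auto simp: progress_def)
  let ?t = "run N (test 1 removable_fm) s"
  have fr: "?t a = s a" if "a < var 1" for a using that by (rule run_test_frame)
  have dom: "\<And>x y. r' x y \<Longrightarrow> x < N \<and> y < N" using st by (simp add: stage_def)
  have "\<And>x. x < 1 \<Longrightarrow> s (var x) 0 = (\<lambda>x. v) x \<and> (\<lambda>x. v) x < N" using v by auto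
  from run_test[OF s' closed_at_fms(1) this]
  have t: "?t (val 1) 0 \<noteq> 0 \<longleftrightarrow> removable r' k' v"
    using sat_removable_fm[of r' N k' "\<lambda>x. v"] dom by auto
  have tr: "represents N r' k' ?t"
    using s' fr by (subst represents_cong[of _ s]) (auto simp: var_def)
  have tv: "?t (var 0) 0 = v" using fr v by (auto simp: var_def)
  show ?thesis
  proof (cases "removable r' k' v")
    case True
    then have run: "run N try_delete s = run N delete_prog ?t" using t by (simp add: try_delete_def)
    have "represents N (del_vertex r' v) k' (run N delete_prog ?t)"
      using represents_delete_prog[OF tr tv v(2)] .
    moreover have "card (editable pol (del_vertex r' v)) < card (editable pol r) \<and> \<not> reduced pol r k"
      using stage_del_vertex(2)[OF st True] True alt by (auto simp: reduced_def)
    ultimately show ?thesis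
      unfolding progress_def run using stage_del_vertex(1)[OF st True] by blast
  next
    case False
    then have "run N try_delete s = ?t" using t by (auto simp: try_delete_def)
    then show ?thesis unfolding progress_def using tr st alt False by auto
  qed
qed

lemma try_flip_frame: "run N (try_flip pol) s (var 0) = s (var 0)"
  by (rule run_frame) (auto simp: try_flip_def flip_prog_def var_def dest!: writes_test)

lemma progress_flips:
  assumes "progress N pol r0 k0 r k B s"
  shows "progress N pol r0 k0 r k (B \<and> (\<forall>p<N. \<forall>q<N. \<not> (k > 0 \<and> forced pol r k p q)))
    (run N (For (var 0) (For (var 1) (try_flip pol))) s)"
proof (rule run_For_induct[where I = "\<lambda>p. progress N pol r0 k0 r k
    (B \<and> (\<forall>p'<p. \<forall>q<N. \<not> (k > 0 \<and> forced pol r k p' q)))"])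
  let ?P = "progress N pol r0 k0 r k"
  let ?F = "\<lambda>p q. \<not> (k > 0 \<and> forced pol r k p q)"
  show "?P (B \<and> (\<forall>p'<0. \<forall>q<N. ?F p' q)) s" using assms by simp
  fix p s
  assume p: "p < N" and I: "?P (B \<and> (\<forall>p'<p. \<forall>q<N. ?F p' q)) s"
  show "?P (B \<and> (\<forall>p'<Suc p. \<forall>q<N. ?F p' q)) (run N (For (var 1) (try_flip pol)) (upd s (var 0) 0 p))"
  proof (rule run_For_induct[where I = "\<lambda>q s. ?P ((B \<and> (\<forall>p'<p. \<forall>q<N. ?F p' q)) \<and> (\<forall>q'<q. ?F p q')) s \<and>
      s (var 0) 0 = p"])
    show "?P ((B \<and> (\<forall>p'<p. \<forall>q<N. ?F p' q)) \<and> (\<forall>q'<0. ?F p q')) (upd s (var 0) 0 p) \<and>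
        upd s (var 0) 0 p (var 0) 0 = p"
      using I by (subst progress_cong[of _ s]) (auto simp: upd_def var_def)
  next
    fix q s'
    assume q: "q < N" and "?P ((B \<and> (\<forall>p'<p. \<forall>q<N. ?F p' q)) \<and> (\<forall>q'<q. ?F p q')) s' \<and> s' (var 0) 0 = p"
    then have J': "?P ((B \<and> (\<forall>p'<p. \<forall>q<N. ?F p' q)) \<and> (\<forall>q'<q. ?F p q')) s'" "s' (var 0) 0 = p"
      by auto
    have J: "?P ((B \<and> (\<forall>p'<p. \<forall>q<N. ?F p' q)) \<and> (\<forall>q'<q. ?F p q')) (upd s' (var 1) 0 q)"
      "upd s' (var 1) 0 q (var 0) 0 = p"
      using J' progress_cong[of "upd s' (var 1) 0 q" s'] by (auto simp: upd_def var_def)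
    have "?P (((B \<and> (\<forall>p'<p. \<forall>q<N. ?F p' q)) \<and> (\<forall>q'<q. ?F p q')) \<and> ?F p q)
        (run N (try_flip pol) (upd s' (var 1) 0 q))"
      by (rule progress_try_flip[OF J _ p q]) simp
    moreover have "(\<forall>q'<Suc q. ?F p q') \<longleftrightarrow> (\<forall>q'<q. ?F p q') \<and> ?F p q"
      by (auto simp: less_Suc_eq)
    ultimately show "?P ((B \<and> (\<forall>p'<p. \<forall>q<N. ?F p' q)) \<and> (\<forall>q'<Suc q. ?F p q'))
        (run N (try_flip pol) (upd s' (var 1) 0 q)) \<and>
        run N (try_flip pol) (upd s' (var 1) 0 q) (var 0) 0 = p"
      using J(2) by (simp only: conj_assoc try_flip_frame)
  next
    fix s' assume "?P ((B \<and> (\<forall>p'<p. \<forall>q<N. ?F p' q)) \<and> (\<forall>q'<N. ?F p q')) s' \<and> s' (var 0) 0 = p"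
    moreover have "(\<forall>p'<Suc p. \<forall>q<N. ?F p' q) \<longleftrightarrow> (\<forall>p'<p. \<forall>q<N. ?F p' q) \<and> (\<forall>q'<N. ?F p q')"
      by (auto simp: less_Suc_eq)
    ultimately show "?P (B \<and> (\<forall>p'<Suc p. \<forall>q<N. ?F p' q)) (upd s' (var 1) 0 N)"
      by (subst progress_cong[of _ s']) (auto simp: upd_def var_def)
  qed
next
  fix s assume "progress N pol r0 k0 r k (B \<and> (\<forall>p'<N. \<forall>q<N. \<not> (k > 0 \<and> forced pol r k p' q))) s"
  then show "progress N pol r0 k0 r k (B \<and> (\<forall>p<N. \<forall>q<N. \<not> (k > 0 \<and> forced pol r k p q))) (upd s (var 0) 0 N)"
    by (subst progress_cong[of _ s]) (auto simp: upd_def var_def)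
qed

lemma progress_deletes:
  assumes "progress N pol r0 k0 r k B s"
  shows "progress N pol r0 k0 r k (B \<and> (\<forall>v<N. \<not> removable r k v)) (run N (For (var 0) try_delete) s)"
proof (rule run_For_induct[where I = "\<lambda>v. progress N pol r0 k0 r k (B \<and> (\<forall>v'<v. \<not> removable r k v'))"])
  let ?P = "progress N pol r0 k0 r k"
  show "?P (B \<and> (\<forall>v'<0. \<not> removable r k v')) s" using assms by simp
  fix v s
  assume v: "v < N" and I: "?P (B \<and> (\<forall>v'<v. \<not> removable r k v')) s"
  have "?P (B \<and> (\<forall>v'<v. \<not> removable r k v')) (upd s (var 0) 0 v)"
    using I by (subst progress_cong[of _ s]) (auto simp: upd_def var_def)
  from progress_try_delete[OF this _ v]
  have "?P ((B \<and> (\<forall>v'<v. \<not> removable r k v')) \<and> \<not> removable r k v) (run N try_delete (upd s (var 0) 0 v))"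
    by simp
  moreover have "(\<forall>v'<Suc v. \<not> removable r k v') \<longleftrightarrow> (\<forall>v'<v. \<not> removable r k v') \<and> \<not> removable r k v"
    by (auto simp: less_Suc_eq)
  ultimately show "?P (B \<and> (\<forall>v'<Suc v. \<not> removable r k v')) (run N try_delete (upd s (var 0) 0 v))"
    by (simp only: conj_assoc)
next
  fix s assume "progress N pol r0 k0 r k (B \<and> (\<forall>v'<N. \<not> removable r k v')) s"
  then show "progress N pol r0 k0 r k (B \<and> (\<forall>v<N. \<not> removable r k v)) (upd s (var 0) 0 N)"
    by (subst progress_cong[of _ s]) (auto simp: upd_def var_def)
qed

lemma progress_round:
  assumes s: "represents N r k s" and st: "stage N pol r0 k0 r k"
  shows "progress N pol r0 k0 r k (reduced pol r k)
    (run N (For (var 0) (For (var 1) (try_flip pol)) ;; For (var 0) try_delete) s)"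
proof -
  have "progress N pol r0 k0 r k True s" using s st by (auto simp: progress_def)
  from progress_deletes[OF progress_flips[OF this]]
  have p: "progress N pol r0 k0 r k
     ((True \<and> (\<forall>p<N. \<forall>q<N. \<not> (k > 0 \<and> forced pol r k p q))) \<and> (\<forall>v<N. \<not> removable r k v))
     (run N (For (var 0) (For (var 1) (try_flip pol)) ;; For (var 0) try_delete) s)"
    unfolding run.simps(2) .
  have "(True \<and> (\<forall>p<N. \<forall>q<N. \<not> (k > 0 \<and> forced pol r k p q))) \<and> (\<forall>v<N. \<not> removable r k v) \<longleftrightarrow> reduced pol r k"
  proof -
    have "p < N \<and> q < N" if "forced pol r k p q" for p q
      using that st unfolding forced_def stage_def by blast
    moreover have "v < N" if "removable r k v" for v
      using that st unfolding removable_def stage_def by blast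
    ultimately show ?thesis unfolding reduced_def by blast
  qed
  with p show ?thesis by simp
qed

text \<open>After \<open>m\<close> rounds, the instance is reduced or the measure is at most
  \<open>N * N - m\<close>. A reduced instance is left unchanged by later rounds.\<close>

lemma run_reduce_prog:
  assumes s: "represents N r k s" and st: "stage N pol r0 k0 r k"
  shows "\<exists>r' k'. represents N r' k' (run N (reduce_prog pol) s) \<and> stage N pol r0 k0 r' k' \<and> reduced pol r' k'"
proof -
  let ?Q = "\<lambda>m s. \<exists>r k. represents N r k s \<and> stage N pol r0 k0 r k \<and>
      (card (editable pol r) + m \<le> N * N \<or> reduced pol r k)"
  have Qc: "?Q m (upd s a 0 j) \<longleftrightarrow> ?Q m s" if "a = 8 \<or> a = 9" for m s a j
  proof -
    have "represents N r k (upd s a 0 j) \<longleftrightarrow> represents N r k s" for r k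
      using that by (intro represents_cong) (auto simp: upd_def)
    then show ?thesis by simp
  qed
  let ?body = "For (var 0) (For (var 1) (try_flip pol)) ;; For (var 0) try_delete"
  have step: "?Q (Suc m) (run N ?body s)" if "?Q m s" for m s
  proof -
    from that obtain r k where r: "represents N r k s" "stage N pol r0 k0 r k"
      "card (editable pol r) + m \<le> N * N \<or> reduced pol r k" by blast
    from progress_round[OF r(1,2)] obtain r' k' where
      r': "represents N r' k' (run N ?body s)" "stage N pol r0 k0 r' k'" and
      alt: "r' = r \<and> k' = k \<and> reduced pol r k \<or>
         card (editable pol r') < card (editable pol r) \<and> \<not> reduced pol r k"
      unfolding progress_def by blast
    have "card (editable pol r') + Suc m \<le> N * N \<or> reduced pol r' k'" using alt r(3) by auto
    then show ?thesis using r' by blast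
  qed
  have "?Q (N * N) (run N (reduce_prog pol) s)"
    unfolding reduce_prog_def
  proof (rule run_For_induct[where I = "\<lambda>i. ?Q (i * N)"])
    show "?Q (0 * N) s" using s st card_editable(2)[OF st] by auto
  next
    fix i s assume Q: "?Q (i * N) s"
    have "?Q (i * N + N) (run N (For 9 ?body) (upd s 8 0 i))"
    proof (rule run_For_induct[where I = "\<lambda>j. ?Q (i * N + j)"])
      show "?Q (i * N + 0) (upd s 8 0 i)" using Q Qc[of 8] by simp
    next
      fix j s assume "?Q (i * N + j) s"
      then have "?Q (i * N + j) (upd s 9 0 j)" using Qc[of 9] by blast
      from step[OF this] show "?Q (i * N + Suc j) (run N ?body (upd s 9 0 j))" by simp
    next
      fix s assume "?Q (i * N + N) s"
      then show "?Q (i * N + N) (upd s 9 0 N)" using Qc[of 9] by blast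
    qed
    then show "?Q (Suc i * N) (run N (For 9 ?body) (upd s 8 0 i))" by (simp add: add.commute)
  next
    fix s assume "?Q (N * N) s"
    then show "?Q (N * N) (upd s 8 0 N)" using Qc[of 8] by blast
  qed
  then obtain r' k' where r': "represents N r' k' (run N (reduce_prog pol) s)" "stage N pol r0 k0 r' k'"
    and alt: "card (editable pol r') + N * N \<le> N * N \<or> reduced pol r' k'" by blast
  \<comment> \<open>Measure 0 means an empty diagonal, hence no vertices to which a rule could
    apply.\<close>
  have "reduced pol r' k'"
  proof (rule ccontr)
    assume "\<not> reduced pol r' k'"
    moreover from this have "editable pol r' = {}" using alt card_editable(1)[OF r'(2)] by simp
    then have "\<not> r' x x" for x by (auto simp: editable_def)
    ultimately show False by (auto simp: reduced_def forced_def removable_def)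
  qed
  then show ?thesis using r' by blast
qed

section \<open>Reading the input, testing the size and writing the output\<close>

text \<open>Register 6 accumulates the row offset \<open>i * N\<close> by addition. The diagonal
  entry is set after its row is copied, because the relation is reflexive while the adjacency matrix
  is zero there.\<close>

definition init_prog :: prog where
  "init_prog = For 8 (Put 4 (reg 8) (reg 6) ;;
     For 9 (Put 3 (Plus (reg 6) (reg 9)) (Cell 1 (Plus (reg 6) (reg 9)))) ;;
     Put 3 (Plus (reg 6) (reg 8)) (Num 1) ;;
     Put 6 (Num 0) (Plus (reg 6) (reg 2)))"

lemma run_init_row:
  fixes s :: store
  assumes "s 6 0 = m"
  shows "\<forall>j. run N (For 9 (Put 3 (Plus (reg 6) (reg 9)) (Cell 1 (Plus (reg 6) (reg 9))))) s 3 j =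
      (if m \<le> j \<and> j < m + N then s 1 j else s 3 j)"
proof (rule run_For_induct[where I = "\<lambda>z s'. s' 6 0 = m \<and> s' 1 = s 1 \<and>
    (\<forall>j. s' 3 j = (if m \<le> j \<and> j < m + z then s 1 j else s 3 j))"])
  fix z and s' :: store assume "s' 6 0 = m \<and> s' 1 = s 1 \<and> (\<forall>j. s' 3 j = (if m \<le> j \<and> j < m + z then s 1 j else s 3 j))"
  then show "run N (Put 3 (Plus (reg 6) (reg 9)) (Cell 1 (Plus (reg 6) (reg 9)))) (upd s' 9 0 z) 6 0 = m \<and>
      run N (Put 3 (Plus (reg 6) (reg 9)) (Cell 1 (Plus (reg 6) (reg 9)))) (upd s' 9 0 z) 1 = s 1 \<and>
      (\<forall>j. run N (Put 3 (Plus (reg 6) (reg 9)) (Cell 1 (Plus (reg 6) (reg 9)))) (upd s' 9 0 z) 3 j =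
        (if m \<le> j \<and> j < m + Suc z then s 1 j else s 3 j))"
    by (auto simp: fun_eq_iff)
qed (use assms in auto)

lemma run_init_prog:
  assumes G: "simple_graph G" "verts G = {..<N}"
  shows "represents N (rel_of G) k (run N init_prog (upd (input_store G k) 2 0 N))"
proof -
  let ?s0 = "upd (input_store G k) 2 0 N"
  let ?row = "For 9 (Put 3 (Plus (reg 6) (reg 9)) (Cell 1 (Plus (reg 6) (reg 9))))"
  let ?body = "Put 4 (reg 8) (reg 6) ;; ?row ;;
     Put 3 (Plus (reg 6) (reg 8)) (Num 1) ;; Put 6 (Num 0) (Plus (reg 6) (reg 2))"
  let ?I = "\<lambda>i s. (\<forall>a\<in>{0,1,2}. s a = ?s0 a) \<and> s 6 0 = i * N \<and> (\<forall>i'<i. s 4 i' = i' * N) \<and>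
     (\<forall>i'<i. \<forall>j<N. s 3 (i' * N + j) = of_bool (rel_of G i' j))"
  have input: "?s0 1 (i * N + j) = of_bool ({i, j} \<in> edges G)" if "i < N" "j < N" for i j
  proof -
    have "i * N + j < Suc i * N" using that by simp
    also have "\<dots> \<le> N * N" using that by (intro mult_right_mono) auto
    finally show ?thesis using that G by (auto simp: input_store_def)
  qed
  show ?thesis unfolding init_prog_def
  proof (rule run_For_induct[where I = ?I])
    show "?I 0 ?s0" by (simp add: input_store_def)
  next
    fix i s assume i: "i < N" and I: "?I i s"
    let ?u = "run N (Put 4 (reg 8) (reg 6)) (upd s 8 0 i)"
    let ?w = "run N ?row ?u"
    have u: "?u 6 0 = i * N" "?u 3 = s 3" "?u 0 = s 0" "?u 1 = s 1" "?u 2 = s 2" "?u 8 0 = i"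
      "\<And>j. ?u 4 j = (if j = i then i * N else s 4 j)"
      using I by (auto simp: fun_eq_iff)
    have w: "?w a = ?u a" if "a \<noteq> 3" "a \<noteq> 9" for a using that by (intro run_frame) auto
    have w3: "?w 3 j = (if i * N \<le> j \<and> j < i * N + N then s 1 j else s 3 j)" for j
      using run_init_row[of ?u "i * N" N] u by simp
    have final: "run N ?body (upd s 8 0 i) = upd (upd ?w 3 (i * N + i) 1) 6 0 (i * N + N)"
      using w u I by (auto simp: fun_eq_iff)
    have "upd (upd ?w 3 (i * N + i) 1) 6 0 (i * N + N) 3 (i' * N + j) = of_bool (rel_of G i' j)"
      if "i' < Suc i" "j < N" for i' j
    proof (cases "i' = i")
      case True
      then show ?thesis using that i w3 I input[OF i that(2)] G rel_of_refl[OF G(1), of i]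
        by (auto simp: rel_of_edge)
    next
      case False
      then have "i' < i" using that by simp
      moreover have "Suc i' * N \<le> i * N" using \<open>i' < i\<close> by (intro mult_right_mono) auto
      then have "i' * N + j < i * N" using that by simp
      ultimately show ?thesis using that w3 I by auto
    qed
    then show "?I (Suc i) (run N ?body (upd s 8 0 i))"
      unfolding final using w u I by (auto simp: fun_eq_iff less_Suc_eq)
  next
    fix s assume "?I N s"
    then show "represents N (rel_of G) k (upd s 8 0 N)"
      by (auto simp: represents_def input_store_def)
  qed
qed

text \<open>Array 5 lists the remaining vertices and register 7 counts them. Each diagonal entry is
  cleared once it has been read, which turns the relation back into an adjacency matrix.\<close>

definition collect_prog :: prog where
  "collect_prog = For 8 (When (Cell 3 (entry (reg 8) (reg 8)))
     (Put 5 (reg 7) (reg 8) ;; Put 7 (Num 0) (Plus (reg 7) (Num 1)) ;; Put 3 (entry (reg 8) (reg 8)) (Num 0)))"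

lemma run_collect_prog:
  assumes s: "represents N r k s" "s 7 0 = 0"
  defines "L \<equiv> filter (\<lambda>x. r x x) [0..<N]"
  shows "run N collect_prog s 7 0 = length L \<and> (\<forall>m<length L. run N collect_prog s 5 m = L ! m) \<and>
    (\<forall>i<N. \<forall>j<N. run N collect_prog s 3 (i * N + j) = of_bool (r i j \<and> i \<noteq> j))"
proof -
  let ?L = "\<lambda>z. filter (\<lambda>x. r x x) [0..<z]"
  let ?r = "\<lambda>z i j. r i j \<and> (i = j \<longrightarrow> z \<le> i)"
  let ?I = "\<lambda>z s'. represents N (?r z) k s' \<and> s' 7 0 = length (?L z) \<and> (\<forall>m<length (?L z). s' 5 m = ?L z ! m)"
  let ?body = "When (Cell 3 (entry (reg 8) (reg 8)))
     (Put 5 (reg 7) (reg 8) ;; Put 7 (Num 0) (Plus (reg 7) (Num 1)) ;; Put 3 (entry (reg 8) (reg 8)) (Num 0))"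
  have "?I N (run N collect_prog s)"
    unfolding collect_prog_def
  proof (rule run_For_induct[where I = ?I])
    show "?I 0 s" using s by simp
  next
    fix z s' assume z: "z < N" and I: "?I z s'"
    let ?u = "upd s' 8 0 z"
    have test: "aval (Cell 3 (entry (reg 8) (reg 8))) ?u = of_bool (r z z)"
      using I z by (auto simp: represents_def)
    show "?I (Suc z) (run N ?body ?u)"
    proof (cases "r z z")
      case True
      then have "run N ?body ?u = upd (upd (upd ?u 5 (length (?L z)) z) 7 0 (Suc (length (?L z)))) 3 (z * N + z) 0"
        using test I z by (simp add: represents_def)
      then show ?thesis
        using I z True by (auto simp: represents_def index_eq_iff nth_append less_Suc_eq le_Suc_eq)
    next
      case False
      then have "run N ?body ?u = ?u" using test by simp
      moreover have "?r z i j = ?r (Suc z) i j" for i j using False by (auto simp: le_Suc_eq not_less_eq_eq le_less)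
      ultimately show ?thesis using I False by (simp add: represents_def)
    qed
  next
    fix s' assume "?I N s'"
    then show "?I N (upd s' 8 0 N)" by (simp add: represents_def)
  qed
  then show ?thesis unfolding L_def by (auto simp: represents_def)
qed

text \<open>Multiplies by \<open>min N (k + 1)\<close>: a loop has only \<open>N\<close> rounds, and truncating the size bound at \<open>N\<close>
  is harmless.\<close>

definition scale_prog :: "nat \<Rightarrow> nat \<Rightarrow> prog" where
  "scale_prog a b = For 8 (When (Minus (Plus (Cell 0 (Num 1)) (Num 1)) (reg 8))
     (Put b (Num 0) (Plus (reg b) (reg a))))"

lemma run_scale_prog:
  assumes "s 0 1 = k" "s a 0 = c" "s b 0 = 0" "a \<notin> {0, 8}" "b \<notin> {0, 8}" "a \<noteq> b"
  shows "run N (scale_prog a b) s b 0 = c * min N (k + 1)"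
  unfolding scale_prog_def
proof (rule run_For_induct[where I = "\<lambda>z s'. s' 0 1 = k \<and> s' a 0 = c \<and> s' b 0 = c * min z (k + 1)"])
  fix z and s' :: store assume "s' 0 1 = k \<and> s' a 0 = c \<and> s' b 0 = c * min z (k + 1)"
  then show "run N (When (Minus (Plus (Cell 0 (Num 1)) (Num 1)) (reg 8)) (Put b (Num 0) (Plus (reg b) (reg a))))
      (upd s' 8 0 z) 0 1 = k \<and>
    run N (When (Minus (Plus (Cell 0 (Num 1)) (Num 1)) (reg 8)) (Put b (Num 0) (Plus (reg b) (reg a))))
      (upd s' 8 0 z) a 0 = c \<and>
    run N (When (Minus (Plus (Cell 0 (Num 1)) (Num 1)) (reg 8)) (Put b (Num 0) (Plus (reg b) (reg a))))
      (upd s' 8 0 z) b 0 = c * min (Suc z) (k + 1)"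
    using assms(4-6) by (auto simp: min_def)
qed (use assms in auto)

text \<open>Three scalings of 16 give the truncated cubic bound; register 15 becomes nonzero exactly
  if the vertices exceed it.\<close>

definition bound_prog :: prog where
  "bound_prog = Put 11 (Num 0) (Num 16) ;; scale_prog 11 12 ;; scale_prog 12 13 ;; scale_prog 13 14 ;;
     Put 15 (Num 0) (Minus (reg 7) (reg 14))"

lemma run_bound_prog:
  assumes "s 0 1 = k" "s 12 0 = 0" "s 13 0 = 0" "s 14 0 = 0"
  shows "run N bound_prog s 15 0 = s 7 0 - 16 * min N (k + 1) ^ 3"
proof -
  let ?m = "min N (k + 1)"
  have fr: "run N (scale_prog a b) s c = s c" if "c \<noteq> b" "c \<noteq> 8" for a b c s
    using that by (intro run_frame) (simp add: scale_prog_def)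
  define s1 where "s1 = upd s 11 0 16"
  define s2 where "s2 = run N (scale_prog 11 12) s1"
  define s3 where "s3 = run N (scale_prog 12 13) s2"
  define s4 where "s4 = run N (scale_prog 13 14) s3"
  have "s2 12 0 = 16 * ?m" unfolding s2_def using assms by (intro run_scale_prog) (simp_all add: s1_def)
  then have "s3 13 0 = 16 * ?m * ?m" unfolding s3_def
    using assms by (intro run_scale_prog) (simp_all add: s2_def fr s1_def)
  then have "s4 14 0 = 16 * ?m * ?m * ?m" unfolding s4_def
    using assms by (intro run_scale_prog) (simp_all add: s3_def s2_def fr s1_def)
  moreover have "s4 7 0 = s 7 0" by (simp add: s4_def s3_def s2_def fr s1_def)
  moreover have "run N bound_prog s 15 0 = s4 7 0 - s4 14 0"
    by (simp add: bound_prog_def s4_def s3_def s2_def s1_def)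
  ultimately show ?thesis by (simp add: power3_eq_cube mult.assoc)
qed

text \<open>The loops run \<open>N\<close> times, so tests cut them down to the \<open>n\<close>
  remaining vertices. The row offset grows by \<open>n\<close>, the row length of the output
  matrix.\<close>

definition output_prog :: prog where
  "output_prog = Put 0 (Num 0) (reg 7) ;; Put 6 (Num 0) (Num 0) ;;
     For 8 (When (Minus (reg 7) (reg 8))
       (For 9 (When (Minus (reg 7) (reg 9)) (Put 1 (Plus (reg 6) (reg 9))
          (Cell 3 (entry (Cell 5 (reg 8)) (Cell 5 (reg 9)))))) ;;
        Put 6 (Num 0) (Plus (reg 6) (reg 7))))"

lemma run_output_row:
  fixes s :: store
  assumes "s 6 0 = m" "s 8 0 = i" "s 7 0 = n" "n \<le> N"
  shows "\<forall>j. run N (For 9 (When (Minus (reg 7) (reg 9)) (Put 1 (Plus (reg 6) (reg 9))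
          (Cell 3 (entry (Cell 5 (reg 8)) (Cell 5 (reg 9))))))) s 1 j =
      (if m \<le> j \<and> j < m + n then s 3 (s 4 (s 5 i) + s 5 (j - m)) else s 1 j)"
    (is "\<forall>j. run N (For 9 ?b) s 1 j = _")
proof (rule run_For_induct[where I = "\<lambda>z s'. (\<forall>a\<in>{3,4,5,6,7,8}. s' a = s a) \<and>
    (\<forall>j. s' 1 j = (if m \<le> j \<and> j < m + min z n then s 3 (s 4 (s 5 i) + s 5 (j - m)) else s 1 j))"])
  fix z and s' :: store
  assume I: "(\<forall>a\<in>{3,4,5,6,7,8}. s' a = s a) \<and>
    (\<forall>j. s' 1 j = (if m \<le> j \<and> j < m + min z n then s 3 (s 4 (s 5 i) + s 5 (j - m)) else s 1 j))"
  have "run N ?b (upd s' 9 0 z) a = s a" if "a \<in> {3,4,5,6,7,8}" for a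
    using that I by (subst run_frame) (auto simp: upd_def)
  moreover have "run N ?b (upd s' 9 0 z) 1 j =
      (if z < n \<and> j = m + z then s 3 (s 4 (s 5 i) + s 5 z) else s' 1 j)" for j
    using I assms by auto
  ultimately show "(\<forall>a\<in>{3,4,5,6,7,8}. run N ?b (upd s' 9 0 z) a = s a) \<and>
    (\<forall>j. run N ?b (upd s' 9 0 z) 1 j =
      (if m \<le> j \<and> j < m + min (Suc z) n then s 3 (s 4 (s 5 i) + s 5 (j - m)) else s 1 j))"
    using I by (auto simp: min_def split: if_splits)
qed (use assms in \<open>auto simp: min_def\<close>)

lemma run_output_prog:
  assumes n: "s 7 0 = n" "n \<le> N"
  shows "run N output_prog s 0 0 = n \<and> run N output_prog s 0 1 = s 0 1 \<and>
    (\<forall>i<n. \<forall>j<n. run N output_prog s 1 (i * n + j) = s 3 (s 4 (s 5 i) + s 5 j))"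
proof -
  let ?s = "upd (upd s 0 0 n) 6 0 0"
  let ?row = "For 9 (When (Minus (reg 7) (reg 9)) (Put 1 (Plus (reg 6) (reg 9))
          (Cell 3 (entry (Cell 5 (reg 8)) (Cell 5 (reg 9))))))"
  let ?b = "When (Minus (reg 7) (reg 8)) (?row ;; Put 6 (Num 0) (Plus (reg 6) (reg 7)))"
  let ?I = "\<lambda>z s'. (\<forall>a\<in>{0,3,4,5,7}. s' a = ?s a) \<and> s' 6 0 = min z n * n \<and>
     (\<forall>i<min z n. \<forall>j<n. s' 1 (i * n + j) = s 3 (s 4 (s 5 i) + s 5 j))"
  have start: "run N output_prog s = run N (For 8 ?b) ?s" using n by (simp add: output_prog_def)
  have "?I N (run N (For 8 ?b) ?s)"
  proof (rule run_For_induct[where I = ?I])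
    show "?I 0 ?s" by simp
  next
    fix z s' assume z: "z < N" and I: "?I z s'"
    let ?u = "upd s' 8 0 z"
    show "?I (Suc z) (run N ?b ?u)"
    proof (cases "z < n")
      case False
      then have "run N ?b ?u = ?u" using I n by simp
      moreover have "min (Suc z) n = min z n" using False by simp
      ultimately show ?thesis using I by (auto simp: upd_def)
    next
      case True
      define w where "w = run N ?row ?u"
      have wf: "w a = ?u a" if "a \<noteq> 1" "a \<noteq> 9" for a unfolding w_def using that by (intro run_frame) auto
      have w1: "w 1 j = (if z * n \<le> j \<and> j < z * n + n then s 3 (s 4 (s 5 z) + s 5 (j - z * n)) else s' 1 j)" for j
        unfolding w_def using run_output_row[of ?u "z * n" z n N] I n True by simp
      have "aval (Minus (reg 7) (reg 8)) ?u \<noteq> 0" using I n True by simp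
      then have "run N ?b ?u = upd w 6 0 (w 6 0 + w 7 0)" by (simp add: w_def del: run.simps(4) aval.simps(4))
      moreover have "w 6 0 = z * n" "w 7 0 = n" using wf I n True by auto
      ultimately have final: "run N ?b ?u = upd w 6 0 (z * n + n)" by simp
      have "w 1 (i * n + j) = s 3 (s 4 (s 5 i) + s 5 j)" if "i < Suc z" "j < n" for i j
      proof (cases "i = z")
        case False
        then have "i < z" using that by simp
        moreover have "Suc i * n \<le> z * n" using \<open>i < z\<close> by (intro mult_right_mono) auto
        then have "i * n + j < z * n" using that by simp
        ultimately show ?thesis using w1 I True that by simp
      qed (use w1 that in simp)
      then show ?thesis unfolding final using wf I True by (auto simp: upd_def min_def)
    qed
  next
    fix s' assume "?I N s'"
    then show "?I N (upd s' 8 0 N)" by (auto simp: upd_def)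
  qed
  then show ?thesis unfolding start using n by (auto simp: min_def)
qed

text \<open>The listed cells are the ones of the adjacency matrix of \<open>P4\<close>.\<close>

definition no_prog :: prog where
  "no_prog = foldr (\<lambda>i p. Put 1 (Num i) (Num (of_bool (i \<in> {1, 4, 6, 9, 11, 14}))) ;; p)
     [0, 1, 2, 3, 4, 5, 6, 7, 8, 9, 10, 11, 12, 13, 14, 15]
     (Put 0 (Num 0) (Num 4) ;; Put 0 (Num 1) (Num 0))"

lemma run_puts:
  "run N (foldr (\<lambda>i p. Put a (Num i) (Num (f i)) ;; p) is q) s =
    run N q (s(a := \<lambda>j. if j \<in> set is then f j else s a j))"
proof (induction "is" arbitrary: s)
  case (Cons i "is")
  have eq: "(upd s a i (f i))(a := \<lambda>j. if j \<in> set is then f j else upd s a i (f i) a j) =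
      s(a := \<lambda>j. if j \<in> set (i # is) then f j else s a j)"
    by (auto simp: fun_eq_iff)
  show ?case unfolding foldr.simps o_apply run.simps aval.simps Cons.IH by (simp only: eq)
qed simp

lemma holds_instance_no_prog: "holds_instance (run N no_prog s) P4 0"
proof -
  have four: "(\<forall>i<4. P i) \<longleftrightarrow> P 0 \<and> P 1 \<and> P 2 \<and> P (3::nat)" for P
    by (auto simp: eval_nat_numeral less_Suc_eq)
  have "verts P4 = {..<4}" by (auto simp: P4_def)
  moreover have "run N no_prog s 0 0 = 4" "run N no_prog s 0 1 = 0"
    unfolding no_prog_def run_puts by simp_all
  moreover have "\<forall>i<4. \<forall>j<4. run N no_prog s 1 (i * 4 + j) = (if {i, j} \<in> edges P4 then 1 else 0)"
    unfolding four no_prog_def run_puts by (simp add: P4_def doubleton_eq_iff)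
  ultimately show ?thesis using simple_graph_P4 by (simp add: holds_instance_def)
qed

text \<open>\<open>no_prog\<close> does not write register 15, so exactly one of the two final
  branches is executed.\<close>

definition kernel_prog :: "bool \<Rightarrow> prog" where
  "kernel_prog pol = init_prog ;; reduce_prog pol ;; collect_prog ;; bound_prog ;;
     When (reg 15) no_prog ;; When (Minus (Num 1) (reg 15)) output_prog"

lemma wf_kernel_prog: "wf_prog (kernel_prog pol)"
proof -
  have t: "wf_prog (test l f)" for l f by (rule wf_prog_test)
  have v: "var 0 = 20" "var 1 = 22" "val 1 = 23" "val 2 = 25" by (simp_all add: var_def val_def)
  have w: "20 \<notin> writes (test 1 f)" "20 \<notin> writes (test 2 f)" "22 \<notin> writes (test 2 f)" for f
    using writes_test[of 20 1 f] writes_test[of 20 2 f] writes_test[of 22 2 f] by (auto simp: var_def)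
  show ?thesis
    by (simp add: kernel_prog_def init_prog_def reduce_prog_def try_flip_def try_delete_def flip_prog_def
        delete_prog_def collect_prog_def bound_prog_def scale_prog_def no_prog_def output_prog_def t v w
        del: One_nat_def)
qed

text \<open>\<open>solvable_pullback\<close> along \<open>f\<close> and along its inverse.\<close>

lemma solvable_bij:
  assumes r: "rgraph r" and f: "bij_betw f S {x. r x x}"
  shows "solvable pol (\<lambda>x y. x \<in> S \<and> y \<in> S \<and> r (f x) (f y)) k \<longleftrightarrow> solvable pol r k"
proof
  have inj: "inj_on f S" and img: "f ` S = {x. r x x}" using f by (auto simp: bij_betw_def)
  show "solvable pol (\<lambda>x y. x \<in> S \<and> y \<in> S \<and> r (f x) (f y)) k" if "solvable pol r k"
    by (rule solvable_pullback[OF r inj _ that]) (use img in auto)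
  let ?g = "\<lambda>x y. x \<in> S \<and> y \<in> S \<and> r (f x) (f y)"
  let ?i = "the_inv_into S f"
  have fS: "r (f x) (f x)" if "x \<in> S" for x using img that by auto
  have "finite S" using inj img rgraph_finite[OF r] by (metis finite_imageD)
  then have g: "rgraph ?g" using r unfolding rgraph_def by auto
  have i: "?i x \<in> S" "f (?i x) = x" if "r x x" for x
    using that the_inv_into_into[OF inj, of x S] f_the_inv_into_f[OF inj, of x] img by auto
  have ii: "inj_on ?i {x. r x x}" using i(2) by (metis (mono_tags) inj_onI mem_Collect_eq)
  assume "solvable pol ?g k"
  then have "solvable pol (\<lambda>x y. x \<in> {x. r x x} \<and> y \<in> {x. r x x} \<and> ?g (?i x) (?i y)) k"
    by (intro solvable_pullback[OF g ii]) (use i fS in auto)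
  moreover have "(\<lambda>x y. x \<in> {x. r x x} \<and> y \<in> {x. r x x} \<and> ?g (?i x) (?i y)) = r"
    using i rgraph_refl1[OF r] rgraph_refl2[OF r] by (intro ext) auto
  ultimately show "solvable pol r k" by simp
qed

lemma kernel_prog_correct:
  assumes G: "simple_graph G" "verts G = {..<N}"
  shows "\<exists>G' k'. holds_instance (run N (kernel_prog pol) (upd (input_store G k) 2 0 N)) G' k' \<and>
    (edit_problem pol G' k' \<longleftrightarrow> edit_problem pol G k) \<and> card (verts G') \<le> 16 * (k + 1) ^ 3 \<and> k' \<le> k"
proof -
  let ?s0 = "upd (input_store G k) 2 0 N"
  define s1 where "s1 = run N init_prog ?s0"
  define s2 where "s2 = run N (reduce_prog pol) s1"
  define s3 where "s3 = run N collect_prog s2"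
  define s4 where "s4 = run N bound_prog s3"
  have r1: "represents N (rel_of G) k s1" unfolding s1_def using G by (rule run_init_prog)
  have "stage N pol (rel_of G) k (rel_of G) k"
    using rgraph_rel_of[OF G(1)] G
    by (auto simp: stage_def rel_of_def dest: simple_graph_edgeD)
  from run_reduce_prog[OF r1 this] obtain r k' where r2: "represents N r k' s2"
    and st: "stage N pol (rel_of G) k r k'" and red: "reduced pol r k'" unfolding s2_def by blast
  have rg: "rgraph r" and dom: "\<And>x y. r x y \<Longrightarrow> x < N \<and> y < N" and kk: "k' \<le> k"
    and eqv: "solvable pol r k' \<longleftrightarrow> edit_problem pol G k"
    using st edit_problem_iff_solvable[OF G(1), of pol k] by (auto simp: stage_def)
  \<comment> \<open>\<open>collect_prog\<close> and \<open>bound_prog\<close> start from zeros in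
    these arrays; they are zero in the input and not written before.\<close>
  have z2: "s2 a = ?s0 a" if "a \<in> {7, 12, 13, 14}" for a
  proof -
    have "a \<notin> writes (reduce_prog pol)" "a \<notin> writes init_prog"
      using that by (auto simp: reduce_prog_def try_flip_def try_delete_def flip_prog_def delete_prog_def
          init_prog_def var_def val_def)
    then show ?thesis unfolding s2_def s1_def by (metis run_frame)
  qed
  have z2': "s2 a 0 = 0" if "a \<in> {7, 12, 13, 14}" for a
    using z2[OF that] that by (auto simp: input_store_def)
  define L where "L = filter (\<lambda>x. r x x) [0..<N]"
  have setL: "set L = {x. r x x}" using dom by (auto simp: L_def)
  have distL: "distinct L" by (simp add: L_def)
  have lenL: "length L = card {x. r x x}" using distinct_card[OF distL] setL by simp
  have lenN: "length L \<le> N" unfolding L_def by (metis diff_zero length_filter_le length_upt)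
  have c3: "s3 7 0 = length L" "\<And>m. m < length L \<Longrightarrow> s3 5 m = L ! m"
    "\<And>i j. i < N \<Longrightarrow> j < N \<Longrightarrow> s3 3 (i * N + j) = of_bool (r i j \<and> i \<noteq> j)"
    using run_collect_prog[OF r2] z2' by (auto simp: s3_def L_def)
  have f3: "s3 a = s2 a" if "a \<notin> {3, 5, 7, 8}" for a
    unfolding s3_def using that by (intro run_frame) (auto simp: collect_prog_def)
  have k3: "s3 0 1 = k'" using f3[of 0] r2 by (simp add: represents_def)
  have b4: "s4 15 0 = length L - 16 * min N (k' + 1) ^ 3"
    unfolding s4_def using run_bound_prog[of s3 k' N] k3 f3 z2' c3 by simp
  have f4: "s4 a = s3 a" if "a \<notin> {8, 11, 12, 13, 14, 15}" for a
    unfolding s4_def using that by (intro run_frame) (auto simp: bound_prog_def scale_prog_def)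
  have mono: "16 * (k' + 1) ^ 3 \<le> 16 * (k + 1) ^ 3" using kk by (intro mult_left_mono power_mono) auto
  have run: "run N (kernel_prog pol) ?s0 =
      run N (When (Minus (Num 1) (reg 15)) output_prog) (run N (When (reg 15) no_prog) s4)"
    by (simp only: kernel_prog_def run.simps(2) s4_def s3_def s2_def s1_def)
  show ?thesis
  proof (cases "length L > 16 * min N (k' + 1) ^ 3")
    case True
    then have pos: "s4 15 0 > 0" using b4 by simp
    have "run N no_prog s4 15 = s4 15" by (rule run_frame) (simp add: no_prog_def)
    then have fin: "run N (kernel_prog pol) ?s0 = run N no_prog s4" unfolding run using pos by simp
    \<comment> \<open>A truncated bound would be \<open>16 * N ^ 3\<close>, which \<open>N\<close>
      vertices cannot exceed; so the bound is the one of
      \<open>reduced_solvable_card_le\<close>.\<close>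
    have "min N (k' + 1) = k' + 1"
    proof (rule ccontr)
      assume "min N (k' + 1) \<noteq> k' + 1"
      then have "min N (k' + 1) = N" by (simp add: min_def split: if_splits)
      moreover have "N \<le> 16 * N ^ 3" by (cases N) (auto simp: power3_eq_cube)
      ultimately show False using True lenN by simp
    qed
    then have "\<not> solvable pol r k'"
      using reduced_solvable_card_le[OF rg red] True lenL by auto
    moreover have "card (verts P4) = 4" by (simp add: P4_def)
    moreover have "4 \<le> 16 * (k + 1) ^ 3" using one_le_power[of "k + 1" 3] by simp
    ultimately show ?thesis
      using holds_instance_no_prog[of N s4] not_edit_problem_P4[of pol] eqv fin
      by (intro exI[of _ P4] exI[of _ 0]) simp
  next
    case False
    let ?n = "length L"
    have fin: "run N (kernel_prog pol) ?s0 = run N output_prog s4"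
      unfolding run using False b4 by simp
    have s4: "s4 7 0 = ?n" "s4 0 1 = k'" using f4 c3 k3 by auto
    note out = run_output_prog[of s4 ?n N, OF s4(1) lenN]
    \<comment> \<open>The remaining vertices are renumbered by their positions in \<open>L\<close>,
      because an output instance has an initial segment as its vertex set.\<close>
    define g where "g = (\<lambda>i j. i \<in> {..<?n} \<and> j \<in> {..<?n} \<and> r (L ! i) (L ! j))"
    have bij: "bij_betw ((!) L) {..<?n} {x. r x x}"
      using bij_betw_nth[OF distL refl setL[symmetric]] .
    have Ln: "r (L ! i) (L ! i)" "L ! i < N" if "i < ?n" for i
      using nth_mem[OF that] setL dom by auto
    have gg: "rgraph g" using rg Ln unfolding rgraph_def g_def by (auto intro: finite_subset[of _ "{..<?n}"])
    have grefl: "g x x \<longleftrightarrow> x \<in> {..<?n}" for x using Ln by (auto simp: g_def)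
    define G' where "G' = Graph {..<?n} {{x, y} | x y. x \<noteq> y \<and> g x y}"
    have "{x. g x x} = {..<?n}" using grefl by auto
    then have sG': "simple_graph G'" using simple_graph_of_rel[OF gg] by (simp add: G'_def)
    have rel: "rel_of G' = g" unfolding G'_def using gg grefl by (rule rel_of_graph_of_rel)
    have "solvable pol g k' \<longleftrightarrow> solvable pol r k'" unfolding g_def using rg bij by (rule solvable_bij)
    then have "edit_problem pol G' k' \<longleftrightarrow> edit_problem pol G k"
      using edit_problem_iff_solvable[OF sG'] rel eqv by metis
    moreover have "holds_instance (run N output_prog s4) G' k'"
      unfolding holds_instance_def
    proof (intro conjI allI impI)
      show "simple_graph G'" by (rule sG')
      show "verts G' = {..<run N output_prog s4 0 0}" using out by (simp add: G'_def)
      show "k' = run N output_prog s4 0 1" using out s4 by simp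
      fix i j assume "i < run N output_prog s4 0 0" "j < run N output_prog s4 0 0"
      then have ij: "i < ?n" "j < ?n" using out by auto
      have r4: "s4 4 (L ! i) = L ! i * N" using f4[of 4] f3[of 4] r2 Ln(2)[OF ij(1)] by (simp add: represents_def)
      have "run N output_prog s4 1 (i * ?n + j) = s4 3 (s4 4 (s4 5 i) + s4 5 j)" using out ij by blast
      also have "\<dots> = s3 3 (L ! i * N + L ! j)" using f4 c3 ij r4 by simp
      also have "\<dots> = of_bool (r (L ! i) (L ! j) \<and> L ! i \<noteq> L ! j)" using c3(3) Ln ij by simp
      also have "r (L ! i) (L ! j) \<and> L ! i \<noteq> L ! j \<longleftrightarrow> i \<noteq> j \<and> g i j"
        using ij nth_eq_iff_index_eq[OF distL ij] by (auto simp: g_def)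
      also have "i \<noteq> j \<and> g i j \<longleftrightarrow> {i, j} \<in> edges G'"
        using rel_of_edge[of i j G'] simple_graph_edgeD(1)[OF sG', of i j] rel by auto
      finally show "run N output_prog s4 1 (i * run N output_prog s4 0 0 + j) = (if {i, j} \<in> edges G' then 1 else 0)"
        using out by simp
    qed
    moreover have "card (verts G') \<le> 16 * (k + 1) ^ 3"
    proof -
      have "card (verts G') = ?n" by (simp add: G'_def)
      also have "\<dots> \<le> 16 * min N (k' + 1) ^ 3" using False by simp
      also have "\<dots> \<le> 16 * (k' + 1) ^ 3" by (intro mult_left_mono power_mono) auto
      also note mono
      finally show ?thesis .
    qed
    ultimately show ?thesis unfolding fin using kk by blast
  qed
qed

lemma computable_id: "computable (\<lambda>k. k)"
  unfolding computable_def using exec_Skip by (intro exI[of _ Skip]) fastforce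

lemma admits_vertex_kernel_edit_problem: "admits_vertex_kernel (edit_problem pol) (\<lambda>k. k ^ 3)"
proof -
  \<comment> \<open>The first assignment, of cost 4, stores the number of vertices as the loop bound
    in array 2, which a well-formed program never writes.\<close>
  let ?c = "Seq (Assign 2 (Num 0) (reg 0)) (com_of (kernel_prog pol))"
  have "polynomial_fun (\<lambda>N. 4 + ptime N (kernel_prog pol))"
    by (intro polynomial_fun_add polynomial_fun_const polynomial_fun_ptime)
  then obtain p :: "nat poly poly" where
    p: "\<And>n k. poly (poly p [:n:]) k = 4 + ptime n (kernel_prog pol)"
    unfolding polynomial_fun_def by blast
  have O: "(\<lambda>k. real (16 * (k + 1) ^ 3)) \<in> O(\<lambda>k. real (k ^ 3))"
  proof (rule bigoI)
    show "\<forall>\<^sub>F k in at_top. norm (real (16 * (k + 1) ^ 3)) \<le> 128 * norm (real (k ^ 3))"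
      using eventually_ge_at_top[of 1]
    proof eventually_elim
      case (elim k)
      \<comment> \<open>For \<open>k\<close> at least 1, \<open>k + 1\<close> is at most
        \<open>2 * k\<close>, whence the constant \<open>16 * 2 ^ 3 = 128\<close>.\<close>
      have "(k + 1) ^ 3 \<le> (2 * k) ^ 3" using elim by (intro power_mono) auto
      then have "16 * (k + 1) ^ 3 \<le> 128 * k ^ 3" by (simp add: power_mult_distrib)
      then have "real (16 * (k + 1) ^ 3) \<le> real (128 * k ^ 3)" by (rule of_nat_mono)
      then show ?case by simp
    qed
  qed
  have "\<exists>t s' G' k'. exec ?c (input_store G k) t s' \<and> t \<le> poly (poly p [:n:]) k \<and>
      holds_instance s' G' k' \<and> (edit_problem pol G' k' \<longleftrightarrow> edit_problem pol G k) \<and>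
      card (verts G') \<le> 16 * (k + 1) ^ 3 \<and> k' \<le> k"
    if G: "simple_graph G" "verts G = {..<n}" for G n k
  proof -
    let ?s0 = "upd (input_store G k) 2 0 n"
    have "exec (Assign 2 (Num 0) (reg 0)) (input_store G k) 4 ?s0"
      using exec_upd[of 2 "Num 0" "reg 0" "input_store G k"] G(2)
      by (simp add: input_store_def eval_nat_numeral)
    moreover obtain t where t: "t \<le> ptime n (kernel_prog pol)"
      "exec (com_of (kernel_prog pol)) ?s0 t (run n (kernel_prog pol) ?s0)"
      using exec_com_of[OF wf_kernel_prog, of ?s0 n pol] by (metis upd_apply)
    ultimately have "exec ?c (input_store G k) (4 + t) (run n (kernel_prog pol) ?s0)"
      by (intro exec_Seq)
    moreover have "4 + t \<le> poly (poly p [:n:]) k" using t(1) p by simp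
    ultimately show ?thesis using kernel_prog_correct[OF G, of pol k] by blast
  qed
  then show ?thesis
    unfolding admits_vertex_kernel_def using O computable_id
    by (intro exI[of _ ?c] exI[of _ p] exI[of _ "\<lambda>k. 16 * (k + 1) ^ 3"] exI[of _ "\<lambda>k. k"]) blast
qed

theorem theorem21:
  "admits_vertex_kernel tp_completion (\<lambda>k. k ^ 3) \<and> admits_vertex_kernel tp_deletion (\<lambda>k. k ^ 3)"
  using admits_vertex_kernel_edit_problem[of False] admits_vertex_kernel_edit_problem[of True]
  by (simp add: edit_problem_def)

end
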